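(* Let $\mathfrak{a}\subset\mathbb{C}\langle X_1,\dots,X_n\rangle$ be a homogeneous two-sided ideal. If $\mathfrak{a}$ contains the commutator ideal, or the anti-commutator ideal, but no non-zero linear form, then $\mathrm{gin}(\mathfrak{a})$ is minimally generated by the images under $\delta$ of the minimal generators of $\mathrm{gin}(\pi(\mathfrak{a}))$, together with the monomials $X_iX_j$ with $i>j$ in the commutator (symmetric algebra) case, respectively $X_iX_j$ with $i\ge j$ in the anti-commutator (exterior algebra) case. Here $\pi$ and $\delta$ are the maps for the symmetric algebra in the first case and for the exterior algebra in the second.
   Context: $V$ is a complex vector space with ordered basis $X_1,\dots,X_n$; the tensor algebra $T(V)$ is identified with the free associative algebra $\mathbb{C}\langle X_1,\dots,X_n\rangle$, whose monomials are the words in the $X_i$. $g=(g_{ij})\in\mathrm{GL}(V)$ acts on it by the algebra automorphism with $g(X_i)=\sum_{\ell} g_{\ell,i}X_\ell$. The commutator ideal is generated by the $X_iX_j-X_jX_i$ ($i<j$), with quotient the symmetric algebra $S(V)$; the anti-commutator ideal is generated by the $X_iX_j+X_jX_i$ ($1\le i\le j\le n$), with quotient the exterior algebra $E(V)$. In either case $\pi$ is the quotient map and $x_i=\pi(X_i)$. Both ideals are invariant under $\mathrm{GL}(V)$, so $\mathrm{GL}(V)$ acts on $S(V)$ and on $E(V)$. $\delta$ is the linear section of $\pi$ with $\delta(x_{i_1}\cdots x_{i_r})=X_{i_1}\cdots X_{i_r}$ for $i_1\le\dots\le i_r$ in the symmetric case and for $i_1<\dots<i_r$ in the exterior case. Monomials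 of $E(V)$ are the $x_{i_1}\cdots x_{i_r}$ with $i_1<\dots<i_r$, considered up to sign. Orders: $\prec_s$ is a monoid well-order on the commutative monomials, used on $S(V)$; its restriction $\prec_e$ to the square-free monomials is used on $E(V)$. Let $<_{lex}$ be the lexicographic order on words with $X_1<_{lex}\cdots<_{lex}X_n$. In the exterior case words are ordered by $\prec_t$ (taken as a monoid well-order): $M\prec_t N$ if (a) $\pi(M),\pi(N)$ are both non-zero and $\pi(M)\prec_e\pi(N)$; or (b) $\pi(M),\pi(N)$ are both non-zero, $\pi(M)=\pi(N)$ (up to sign) and $M<_{lex}N$; or (c) at least one of $\pi(M),\pi(N)$ is $0$ and $M<_{lex}N$. In the symmetric case words are ordered by: $M$ is smaller than $N$ if $\pi(M)\prec_s\pi(N)$, or $\pi(M)=\pi(N)$ and $M<_{lex}N$. The initial ideal of an ideal is the monomial ideal generated by the largest monomials of its non-zero elements. Generic initial ideals: for a homogeneous ideal $\mathfrak{c}$ of $S(V)$ or $E(V)$, $\mathrm{gin}(\mathfrak{c})$ is the monomial ideal equal to the initial ideal of $g(\mathfrak{c})$ for all $g$ in a non-empty Zariski-open subset of $\mathrm{GL}(V)$. For a homogeneous two-sided ideal $\mathfrak{a}\subset T(V)$, $\mathrm{gin}(\mathfrak{a})$ is the monomial ideal equal to the initial ideal of $g(\mathfrak{a})$ for all $g$ in some countable intersection of non-empty Zariski-open subsets of $\mathrm{GL}(V)$.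
   Formalization: Added: for i<j<k, x_j is not smaller than both x_i and x_k in the order on S(V); else generic quadrics give an extra generator X_iX_jX_k. The word order of the exterior case is used as defined by (a)-(c), not assumed to be a monoid well-order. *)

theory Defs
  imports
    "HOL-Analysis.Determinants"
    "HOL-Algebra.QuotRing"
    "HOL-Library.Poly_Mapping"
    "HOL-Library.Multiset"
    "HOL-Library.Countable_Set"
begin

section \<open>The free associative algebra\<close>

text \<open>Words form a monoid under concatenation, so finitely supported functions on words with the
  convolution product are the free associative algebra. The ordered basis $X_1,\dots,X_n$ of $V$ is
  indexed by a finite linearly ordered type \<open>'n\<close>.\<close>

instantiation list :: (type) monoid_add
begin
definition zero_list :: "'a list" where "zero_list = []"
definition plus_list :: "'a list \<Rightarrow> 'a list \<Rightarrow> 'a list" where "plus_list = (@)"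
instance by standard (simp_all add: zero_list_def plus_list_def)
end

type_synonym 'n free_alg = "'n list \<Rightarrow>\<^sub>0 complex"

definition mon :: "'n list \<Rightarrow> 'n free_alg" where
  "mon w = Poly_Mapping.single w 1"

definition X :: "'n \<Rightarrow> 'n free_alg" where
  "X i = mon [i]"

definition scal :: "complex \<Rightarrow> 'n free_alg" where
  "scal c = Poly_Mapping.single [] c"

definition T :: "'n free_alg ring" where
  "T = \<lparr>carrier = UNIV, monoid.mult = (*), one = 1, zero = 0, add = (+)\<rparr>"

lemma ring_T: "ring (T :: 'n free_alg ring)"
proof (rule ringI)
  show "abelian_group (T :: 'n free_alg ring)"
  proof (rule abelian_groupI)
    fix x :: "'n free_alg"
    show "\<exists>y \<in> carrier T. y \<oplus>\<^bsub>T\<^esub> x = \<zero>\<^bsub>T\<^esub>"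
      by (rule bexI[of _ "- x"]) (simp_all add: T_def)
  qed (simp_all add: T_def algebra_simps)
  show "Group.monoid (T :: 'n free_alg ring)"
    by (rule monoidI) (simp_all add: T_def algebra_simps)
qed (simp_all add: T_def algebra_simps)

definition hom_component :: "nat \<Rightarrow> 'n free_alg \<Rightarrow> 'n free_alg" where
  "hom_component d f =
     (\<Sum>w \<in> {w \<in> Poly_Mapping.keys f. length w = d}. Poly_Mapping.single w (Poly_Mapping.lookup f w))"

definition homogeneous_ideal :: "'n free_alg set \<Rightarrow> bool" where
  "homogeneous_ideal a \<longleftrightarrow> ideal a T \<and> (\<forall>f\<in>a. \<forall>d. hom_component d f \<in> a)"

definition linear_form :: "'n free_alg \<Rightarrow> bool" where
  "linear_form f \<longleftrightarrow> (\<forall>w \<in> Poly_Mapping.keys f. length w = 1)"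

section \<open>The general linear group and its Zariski topology\<close>

definition GL :: "(complex ^ 'n ^ 'n) set" where
  "GL = {g. invertible g}"

definition act :: "complex ^ 'n ^ 'n \<Rightarrow> 'n::finite free_alg \<Rightarrow> 'n free_alg" where
  "act g f = (\<Sum>w \<in> Poly_Mapping.keys f. scal (Poly_Mapping.lookup f w) *
     prod_list (map (\<lambda>i. \<Sum>l\<in>UNIV. scal (g $ l $ i) * X l) w))"

inductive matrix_polynomial :: "(complex ^ 'n ^ 'n \<Rightarrow> complex) \<Rightarrow> bool" where
  const: "matrix_polynomial (\<lambda>_. c)"
| entry: "matrix_polynomial (\<lambda>g. g $ i $ j)"
| add: "matrix_polynomial p \<Longrightarrow> matrix_polynomial q \<Longrightarrow> matrix_polynomial (\<lambda>g. p g + q g)"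
| mult: "matrix_polynomial p \<Longrightarrow> matrix_polynomial q \<Longrightarrow> matrix_polynomial (\<lambda>g. p g * q g)"

text \<open>Dividing by powers of the determinant does not change zero sets in $\mathrm{GL}(V)$, so
  polynomials in the matrix entries suffice.\<close>

definition zariski_open :: "(complex ^ 'n ^ 'n) set \<Rightarrow> bool" where
  "zariski_open U \<longleftrightarrow>
     (\<exists>P. (\<forall>p\<in>P. matrix_polynomial p) \<and> U = {g \<in> GL. \<exists>p\<in>P. p g \<noteq> 0})"

section \<open>Symmetric and exterior algebra as quotients\<close>

text \<open>Both quotients are treated uniformly: \<open>I\<close> is the ideal divided out and \<open>P\<close> singles out the
  words whose images are the monomials of the quotient, that is, the weakly increasing words for
  $S(V)$ and the strictly increasing ones for $E(V)$. Fixing the increasing representative takes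
  care of the signs in $E(V)$.\<close>

definition comm_ideal :: "'n::linorder free_alg set" where
  "comm_ideal = Idl\<^bsub>T\<^esub> {X i * X j - X j * X i | i j. i < j}"

definition anticomm_ideal :: "'n::linorder free_alg set" where
  "anticomm_ideal = Idl\<^bsub>T\<^esub> {X i * X j + X j * X i | i j. i \<le> j}"

definition sym_word :: "'n::linorder list \<Rightarrow> bool" where
  "sym_word w \<longleftrightarrow> sorted_wrt (\<le>) w"

definition ext_word :: "'n::linorder list \<Rightarrow> bool" where
  "ext_word w \<longleftrightarrow> sorted_wrt (<) w"

definition proj :: "'n free_alg set \<Rightarrow> 'n free_alg \<Rightarrow> 'n free_alg set" where
  "proj I f = I +>\<^bsub>T\<^esub> f"

definition quot_monomials :: "'n free_alg set \<Rightarrow> ('n list \<Rightarrow> bool) \<Rightarrow> 'n free_alg set set" where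
  "quot_monomials I P = {proj I (mon w) | w. P w}"

definition std_section ::
  "'n free_alg set \<Rightarrow> ('n list \<Rightarrow> bool) \<Rightarrow> ('n free_alg set \<Rightarrow> 'n free_alg) \<Rightarrow> bool" where
  "std_section I P d \<longleftrightarrow>
     (\<forall>f. proj I (d (proj I f)) = proj I f) \<and>
     (\<forall>f g. d (proj I (f + g)) = d (proj I f) + d (proj I g)) \<and>
     (\<forall>c f. d (proj I (scal c * f)) = scal c * d (proj I f)) \<and>
     (\<forall>w. P w \<longrightarrow> d (proj I (mon w)) = mon w)"

text \<open>The conditions determine the section on the whole quotient, because the monomials singled
  out by \<open>P\<close> span it; only the (irrelevant) values outside the quotient are left open.\<close>

definition delta ::
  "'n free_alg set \<Rightarrow> ('n list \<Rightarrow> bool) \<Rightarrow> 'n free_alg set \<Rightarrow> 'n free_alg" where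
  "delta I P = (SOME d. std_section I P d)"

text \<open>A coset is moved elementwise; this is the induced action when \<open>I\<close> is invariant.\<close>

definition quot_act ::
  "complex ^ 'n ^ 'n \<Rightarrow> 'n::finite free_alg set \<Rightarrow> 'n free_alg set" where
  "quot_act g y = act g ` y"

section \<open>Monomial orders\<close>

text \<open>Commutative monomials are multisets of indices, the square-free ones being the multisets
  without repetition; \<open>mset w\<close> is the commutative monomial of a word \<open>w\<close>.\<close>

definition monoid_well_order :: "('n multiset \<Rightarrow> 'n multiset \<Rightarrow> bool) \<Rightarrow> bool" where
  "monoid_well_order lt \<longleftrightarrow> transp lt \<and> totalp lt \<and> wfp lt \<and>
     (\<forall>k m n. lt m n \<longrightarrow> lt (k + m) (k + n))"

text \<open>Compatibility of the order on commutative monomials with the numbering of the variables. Both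
  conventions $x_1 \prec \dots \prec x_n$ and $x_1 \succ \dots \succ x_n$ satisfy it. It cannot be
  dropped: for $x_2 \prec x_1 \prec x_3$, ordered by degree and then reverse lexicographically, two
  generic quadrics have the generic initial ideal $(x_3^2, x_1 x_3, x_1^3)$, and $X_1 X_2 X_3$ is an
  additional minimal generator in the free algebra.\<close>

definition numbering_compatible :: "('n::linorder multiset \<Rightarrow> 'n multiset \<Rightarrow> bool) \<Rightarrow> bool" where
  "numbering_compatible lt \<longleftrightarrow>
     (\<forall>i j k. i < j \<and> j < k \<longrightarrow> lt {#i#} {#j#} \<or> lt {#k#} {#j#})"

definition lex_less :: "'n::linorder list \<Rightarrow> 'n list \<Rightarrow> bool" where
  "lex_less M N \<longleftrightarrow> (M, N) \<in> lexord {(i, j). i < j}"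

definition sym_word_order ::
  "('n::linorder multiset \<Rightarrow> 'n multiset \<Rightarrow> bool) \<Rightarrow> 'n list \<Rightarrow> 'n list \<Rightarrow> bool" where
  "sym_word_order lt M N \<longleftrightarrow> lt (mset M) (mset N) \<or> (mset M = mset N \<and> lex_less M N)"

text \<open>The clauses for words with image zero do not in general make this relation transitive or
  compatible with concatenation. This is harmless: initial words are taken below in the sense of an
  element of the support that exceeds all others, and for ideals containing the anti-commutator
  ideal the initial ideal does not depend on how words with image zero are compared.\<close>

definition ext_word_order ::
  "('n::linorder multiset \<Rightarrow> 'n multiset \<Rightarrow> bool) \<Rightarrow> 'n list \<Rightarrow> 'n list \<Rightarrow> bool" where
  "ext_word_order lt M N \<longleftrightarrow>
     (mon M \<notin> anticomm_ideal \<and> mon N \<notin> anticomm_ideal \<and> lt (mset M) (mset N)) \<or>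
     (mon M \<notin> anticomm_ideal \<and> mon N \<notin> anticomm_ideal \<and> mset M = mset N \<and> lex_less M N) \<or>
     ((mon M \<in> anticomm_ideal \<or> mon N \<in> anticomm_ideal) \<and> lex_less M N)"

section \<open>Initial ideals and generic initial ideals\<close>

definition initial_word :: "('n list \<Rightarrow> 'n list \<Rightarrow> bool) \<Rightarrow> 'n free_alg \<Rightarrow> 'n list \<Rightarrow> bool" where
  "initial_word ord f w \<longleftrightarrow>
     w \<in> Poly_Mapping.keys f \<and> (\<forall>v \<in> Poly_Mapping.keys f. v \<noteq> w \<longrightarrow> ord v w)"

definition init_T :: "('n list \<Rightarrow> 'n list \<Rightarrow> bool) \<Rightarrow> 'n free_alg set \<Rightarrow> 'n free_alg set" where
  "init_T ord a = Idl\<^bsub>T\<^esub> {mon w | f w. f \<in> a \<and> initial_word ord f w}"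

definition gin_T ::
  "('n list \<Rightarrow> 'n list \<Rightarrow> bool) \<Rightarrow> 'n::finite free_alg set \<Rightarrow> 'n free_alg set" where
  "gin_T ord a = (THE J. \<exists>\<U>. countable \<U> \<and> (\<forall>U\<in>\<U>. zariski_open U \<and> U \<noteq> {}) \<and>
     (\<forall>g \<in> GL \<inter> \<Inter>\<U>. init_T ord (act g ` a) = J))"

text \<open>The words in the support of \<open>delta I P y\<close> are the monomials in the expansion of \<open>y\<close>.\<close>

definition init_Q ::
  "'n free_alg set \<Rightarrow> ('n list \<Rightarrow> bool) \<Rightarrow> ('n multiset \<Rightarrow> 'n multiset \<Rightarrow> bool) \<Rightarrow>
     'n free_alg set set \<Rightarrow> 'n free_alg set set" where
  "init_Q I P lt c = Idl\<^bsub>T Quot I\<^esub>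
     {proj I (mon w) | y w. y \<in> c \<and> initial_word (\<lambda>v w. lt (mset v) (mset w)) (delta I P y) w}"

definition gin_Q ::
  "'n::finite free_alg set \<Rightarrow> ('n list \<Rightarrow> bool) \<Rightarrow> ('n multiset \<Rightarrow> 'n multiset \<Rightarrow> bool) \<Rightarrow>
     'n free_alg set set \<Rightarrow> 'n free_alg set set" where
  "gin_Q I P lt c = (THE J. \<exists>U. zariski_open U \<and> U \<noteq> {} \<and>
     (\<forall>g\<in>U. init_Q I P lt (quot_act g ` c) = J))"

section \<open>Minimal generation\<close>

definition minimally_generates :: "('r, 'm) ring_scheme \<Rightarrow> 'r set \<Rightarrow> 'r set \<Rightarrow> bool" where
  "minimally_generates R B J \<longleftrightarrow> Idl\<^bsub>R\<^esub> B = J \<and> (\<forall>C. C \<subset> B \<longrightarrow> Idl\<^bsub>R\<^esub> C \<noteq> J)"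

text \<open>\<open>Mon\<close> is the set of monomials of \<open>R\<close>; a monomial ideal has exactly one minimal generating
  set consisting of monomials.\<close>

definition min_gens :: "('r, 'm) ring_scheme \<Rightarrow> 'r set \<Rightarrow> 'r set \<Rightarrow> 'r set" where
  "min_gens R Mon J = (THE B. B \<subseteq> Mon \<and> minimally_generates R B J)"

end

theory Submission
  imports Defs "HOL-Analysis.Analysis"
begin

text \<open>Both cases of the theorem are one statement about the relations $X_i X_j = q X_j X_i$ for
  $i < j$, with $q = 1$ for $S(V)$, and with $q = -1$ and the additional relations $X_i^2 = 0$ for
  $E(V)$. Sorting the letters of a word and collecting a coefficient $1$, $-1$ or $0$ is a linear
  normal form \<open>nf\<close>, whose kernel is the ideal \<open>I\<close> of relations; it is \<open>delta\<close> after the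
  projection. The words with a non-zero coefficient that are already sorted are called standard.

  A word that is not standard is the initial word of a relation, namely of its difference with its
  normal form. A standard word is lexicographically minimal among the words with the same commutative
  image, so it is an initial word in an ideal \<open>a\<close> containing \<open>I\<close> if and only if its image is an
  initial monomial in the image of \<open>a\<close>. Hence the initial ideal of $g(a)$ is generated by the
  non-standard words and by the standard words of the initial monomials downstairs
  (\<open>init_T_eq\<close>), and the two generic initial ideals determine each other.

  It remains to compare minimal generators. In the free algebra a generator has to divide as a
  contiguous factor, in the quotient it is enough to divide as a commutative monomial. The
  difference is bridged by strong stability of the generic initial ideal: in a monomial of it,
  a variable may be replaced by a larger one. Let \<open>w\<close> be a standard word whose monomial stays in
  the ideal when some letter \<open>x\<close> is removed. If \<open>x\<close> is not the first or last letter, compatibility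
  of the order with the numbering makes \<open>x\<close> larger than the first or than the last letter of \<open>w\<close>.
  Replacing that letter by \<open>x\<close> shows that \<open>w\<close> without its first or without its last letter belongs
  to the ideal (\<open>gin_words_shorten\<close>), and induction on the length yields a minimal generator that
  is a factor (\<open>gin_words_minimal_factor\<close>).

  Generic initial ideals are obtained from polynomial families $F(g) = \sum_k p_k(g)\, g(f_k)$ with
  $f_k$ in a homogeneous part \<open>W\<close> of \<open>a\<close> and polynomials $p_k$ in the matrix entries. Call a monomial
  generic if it is the largest one whose coefficient in some family does not vanish identically.
  Fraction-free Gaussian elimination among families shows that, away from the zeros of finitely many
  leading coefficients, the initial monomials of $g(W)$ are exactly the generic ones
  (\<open>elimination\<close>, \<open>generic_initial_words\<close>). By Dickson's lemma finitely many degrees generate the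
  generic monomials; on the intersection of the corresponding open sets the initial ideal contains
  all generic monomials, and equality holds in the remaining degrees because the number of initial
  monomials of $g(W)$ is the dimension of its image and does not depend on \<open>g\<close>
  (\<open>card_initial_words_le\<close>, \<open>generic_initial_words_eq\<close>).

  Strong stability comes from differentiation. Let $u_t$ map $X_j$ to $X_j + t X_i$ and fix the other
  variables. The derivative of $u_t F(u_t^{-1} g)$ at $t = 0$ is again a polynomial family. If $m$ is
  the leading monomial of \<open>F\<close> and $x_j \prec x_i$, its leading monomial is $m x_i / x_j$, with
  coefficient multiplied by the exponent of $x_j$ in $m$ up to sign, which is non-zero in
  characteristic zero (\<open>generic_words_swap\<close>).\<close>

abbreviation lookup where "lookup \<equiv> Poly_Mapping.lookup"
abbreviation keys where "keys \<equiv> Poly_Mapping.keys"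

section \<open>Linear algebra on words\<close>

lemma scal_mult_single: "scal c * Poly_Mapping.single w d = Poly_Mapping.single w (c * d)"
  by (simp add: scal_def mult_single plus_list_def)

lemma single_eq_scal_mon: "Poly_Mapping.single w c = scal c * mon w"
  by (simp add: scal_mult_single mon_def)

lemma mon_append: "mon (u @ v) = mon u * mon v"
  by (simp add: mon_def mult_single plus_list_def)

lemma mon_Cons: "mon (x # v) = X x * mon v"
  by (simp add: X_def flip: mon_append)

lemma mon_Nil: "mon [] = 1"
  by (simp add: mon_def flip: single_one zero_list_def)

lemma scal_1: "scal 1 = 1"
  using mon_Nil by (simp add: scal_def mon_def)

lemma scal_0: "scal 0 = 0"
  by (simp add: scal_def)

lemma scal_mult: "scal (c * d) = scal c * scal d"
  by (simp add: scal_def mult_single plus_list_def)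

lemma scal_add: "scal (c + d) = scal c + scal d"
  by (simp add: scal_def single_add)

lemma free_alg_induct [case_names mon add]:
  assumes "\<And>c w. Q (scal c * mon w)"
    and "\<And>f g. Q f \<Longrightarrow> Q g \<Longrightarrow> Q (f + g)"
  shows "Q (f :: 'n free_alg)"
proof (induction f rule: update_induct)
  case const
  show ?case using assms(1)[of 0 "[]"] by (simp add: scal_0)
next
  case (update f a b)
  have "Poly_Mapping.update a b f = f + scal b * mon a"
    by (rule poly_mapping_eqI)
      (use update in \<open>auto simp: lookup_update lookup_add single_eq_scal_mon[symmetric]
        lookup_single in_keys_iff when_def\<close>)
  with update assms show ?case by metis
qed

lemma lookup_scal_mult: "lookup (scal c * f) w = c * lookup f w"
proof (induction f rule: free_alg_induct)
  case (mon d v)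
  show ?case
    by (simp add: single_eq_scal_mon[symmetric] scal_mult_single lookup_single when_def)
next
  case (add f g)
  then show ?case by (simp add: distrib_left lookup_add)
qed

lemma lookup_scal_mon: "lookup (scal c * mon v) w = (if v = w then c else 0)"
  by (simp add: single_eq_scal_mon[symmetric] lookup_single when_def)

lemma lookup_mon: "lookup (mon v) w = (if v = w then 1 else 0)"
  by (simp add: mon_def lookup_single when_def)

lemma keys_mon: "keys (mon w) = {w}"
  by (simp add: mon_def)

lemma scal_commute: "f * scal c = scal c * f"
proof (induction f rule: free_alg_induct)
  case (mon d v)
  show ?case
    by (simp add: scal_mult_single single_eq_scal_mon[symmetric])
      (simp add: scal_def mult_single plus_list_def mult.commute)
qed (simp add: distrib_left distrib_right)

lemma scal_left_commute: "f * (scal c * g) = scal c * (f * g)"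
  by (metis mult.assoc scal_commute)

global_interpretation free_alg: vector_space "\<lambda>c f. scal c * (f :: 'n free_alg)"
  by standard (simp_all add: distrib_left distrib_right scal_add scal_mult scal_1 mult.assoc)

lemma scal_minus_1: "scal (- 1) * f = - f"
  using free_alg.scale_minus_left[of 1 f] by (simp add: scal_1)

lemma scal_mult_eq_0: "scal c * f = 0 \<longleftrightarrow> c = 0 \<or> f = 0"
  by (rule free_alg.scale_eq_0_iff)

text \<open>All linear maps used below are given by their values on words.\<close>

definition lin_ext :: "('n list \<Rightarrow> 'm free_alg) \<Rightarrow> 'n free_alg \<Rightarrow> 'm free_alg" where
  "lin_ext b f = (\<Sum>w\<in>keys f. scal (lookup f w) * b w)"

lemma lin_ext_superset:
  assumes "finite A" "keys f \<subseteq> A"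
  shows "lin_ext b f = (\<Sum>w\<in>A. scal (lookup f w) * b w)"
  unfolding lin_ext_def
  by (rule sum.mono_neutral_left) (use assms in \<open>auto simp: in_keys_iff scal_0\<close>)

lemma lin_ext_add: "lin_ext b (f + g) = lin_ext b f + lin_ext b g"
proof -
  let ?A = "keys f \<union> keys g"
  have 1: "lin_ext b (f + g) = (\<Sum>w\<in>?A. scal (lookup (f + g) w) * b w)"
    by (rule lin_ext_superset) (use keys_add[of f g] in auto)
  have 2: "lin_ext b f = (\<Sum>w\<in>?A. scal (lookup f w) * b w)"
    by (rule lin_ext_superset) auto
  have 3: "lin_ext b g = (\<Sum>w\<in>?A. scal (lookup g w) * b w)"
    by (rule lin_ext_superset) auto
  show ?thesis
    unfolding 1 2 3 lookup_add scal_add distrib_right sum.distrib ..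
qed

lemma lin_ext_scal: "lin_ext b (scal c * f) = scal c * lin_ext b f"
proof -
  have "keys (scal c * f) \<subseteq> keys f" by (auto simp: in_keys_iff lookup_scal_mult)
  then have "lin_ext b (scal c * f) = (\<Sum>w\<in>keys f. scal (lookup (scal c * f) w) * b w)"
    by (intro lin_ext_superset) auto
  then show ?thesis
    unfolding lin_ext_def[of b f] sum_distrib_left lookup_scal_mult scal_mult mult.assoc .
qed

lemma lin_ext_mon: "lin_ext b (mon w) = b w"
  by (simp add: lin_ext_def keys_mon lookup_mon scal_1)

lemma lin_ext_0: "lin_ext b 0 = 0"
  by (simp add: lin_ext_def)

lemma lin_ext_uminus: "lin_ext b (- f) = - lin_ext b f"
  using lin_ext_scal[of b "- 1" f] by (simp add: scal_minus_1)

lemma lin_ext_diff: "lin_ext b (f - g) = lin_ext b f - lin_ext b g"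
  using lin_ext_add[of b f "- g"] by (simp add: lin_ext_uminus)

lemma lin_ext_sum: "lin_ext b (sum h A) = (\<Sum>x\<in>A. lin_ext b (h x))"
  by (induction A rule: infinite_finite_induct) (simp_all add: lin_ext_0 lin_ext_add)

lemma lookup_lin_ext: "lookup (lin_ext b f) v = (\<Sum>w\<in>keys f. lookup f w * lookup (b w) v)"
  by (simp add: lin_ext_def lookup_sum lookup_scal_mult)

lemma lin_ext_mon_id: "lin_ext mon f = f"
  by (induction f rule: free_alg_induct) (simp_all add: lin_ext_add lin_ext_scal lin_ext_mon)

lemma lookup_X_mult:
  "lookup (X x * f) w = (case w of [] \<Rightarrow> 0 | y # ys \<Rightarrow> if y = x then lookup f ys else 0)"
proof (induction f rule: free_alg_induct)
  case (mon d v)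
  have "lookup (X x * (scal d * mon v)) w = lookup (scal d * mon (x # v)) w"
    by (simp add: scal_left_commute mon_Cons)
  then show ?case by (auto simp: lookup_scal_mon split: list.splits)
qed (auto simp: distrib_left lookup_add split: list.splits)

section \<open>Ideals of the free algebra\<close>

text \<open>The ideals of the record \<open>T\<close>, expressed by the type class operations (lemma \<open>ideal_T_iff\<close>) so
  that the simplification rules for rings apply.\<close>

definition closed_ideal :: "'n free_alg set \<Rightarrow> bool" where
  "closed_ideal J \<longleftrightarrow> 0 \<in> J \<and> (\<forall>f\<in>J. \<forall>g\<in>J. f + g \<in> J) \<and> (\<forall>f\<in>J. \<forall>r. r * f \<in> J \<and> f * r \<in> J)"

lemma T_simps [simp]:
  "carrier T = UNIV" "x \<otimes>\<^bsub>T\<^esub> y = x * y" "x \<oplus>\<^bsub>T\<^esub> y = x + y" "\<one>\<^bsub>T\<^esub> = 1" "\<zero>\<^bsub>T\<^esub> = 0"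
  by (simp_all add: T_def)

lemma uminus_T: "\<ominus>\<^bsub>T\<^esub> (x :: 'n free_alg) = - x"
proof -
  interpret ring "T :: 'n free_alg ring" by (rule ring_T)
  show ?thesis using add.inv_equality[of "- x" x] by (simp add: a_inv_def)
qed

lemma ideal_T_iff: "ideal J (T :: 'n free_alg ring) \<longleftrightarrow> closed_ideal J"
proof
  assume "ideal J (T :: 'n free_alg ring)"
  then interpret ideal J "T :: 'n free_alg ring" .
  show "closed_ideal J"
    using additive_subgroup.zero_closed[OF is_additive_subgroup]
      additive_subgroup.a_closed[OF is_additive_subgroup] I_l_closed I_r_closed
    by (auto simp: closed_ideal_def)
next
  assume J: "closed_ideal J"
  then have neg: "- f \<in> J" if "f \<in> J" for f
    using that by (metis closed_ideal_def mult_minus1)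
  show "ideal J (T :: 'n free_alg ring)"
  proof (rule idealI[OF ring_T])
    interpret ring "T :: 'n free_alg ring" by (rule ring_T)
    show "subgroup J (add_monoid (T :: 'n free_alg ring))"
      by (rule add.subgroupI)
        (use J neg in \<open>auto simp: closed_ideal_def uminus_T simp flip: a_inv_def\<close>)
  qed (use J in \<open>auto simp: closed_ideal_def\<close>)
qed

lemma closed_ideal_0: "closed_ideal J \<Longrightarrow> 0 \<in> J"
  and closed_ideal_add: "closed_ideal J \<Longrightarrow> f \<in> J \<Longrightarrow> g \<in> J \<Longrightarrow> f + g \<in> J"
  and closed_ideal_left: "closed_ideal J \<Longrightarrow> f \<in> J \<Longrightarrow> r * f \<in> J"
  and closed_ideal_right: "closed_ideal J \<Longrightarrow> f \<in> J \<Longrightarrow> f * r \<in> J"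
  by (auto simp: closed_ideal_def)

lemma closed_ideal_uminus: "closed_ideal J \<Longrightarrow> f \<in> J \<Longrightarrow> - f \<in> J"
  using closed_ideal_left[of J f "- 1"] by simp

lemma closed_ideal_diff: "closed_ideal J \<Longrightarrow> f \<in> J \<Longrightarrow> g \<in> J \<Longrightarrow> f - g \<in> J"
  using closed_ideal_add[of J f "- g"] closed_ideal_uminus by auto

lemma closed_ideal_sum: "closed_ideal J \<Longrightarrow> (\<And>x. x \<in> A \<Longrightarrow> h x \<in> J) \<Longrightarrow> sum h A \<in> J"
  by (induction A rule: infinite_finite_induct) (auto intro: closed_ideal_0 closed_ideal_add)

lemma closed_ideal_cancel_scal:
  assumes "closed_ideal J" "scal c * f \<in> J" "c \<noteq> 0" shows "f \<in> J"
  using closed_ideal_left[OF assms(1,2), of "scal (1 / c)"] assms(3)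
  by (simp add: mult.assoc[symmetric] scal_1 flip: scal_mult)

lemma closed_ideal_Idl: "closed_ideal (Idl\<^bsub>T\<^esub> S)"
  using ring.genideal_ideal[OF ring_T, of S] by (simp add: ideal_T_iff)

lemma Idl_superset: "S \<subseteq> Idl\<^bsub>T\<^esub> S"
  using ring.genideal_self[OF ring_T, of S] by simp

lemma Idl_least: "closed_ideal J \<Longrightarrow> S \<subseteq> J \<Longrightarrow> Idl\<^bsub>T\<^esub> S \<subseteq> J"
  using ring.genideal_minimal[OF ring_T, of J S] by (simp add: ideal_T_iff)

lemma closed_idealI_mon:
  assumes "0 \<in> J" "\<And>f g. f \<in> J \<Longrightarrow> g \<in> J \<Longrightarrow> f + g \<in> J"
    and "\<And>c f. f \<in> J \<Longrightarrow> scal c * f \<in> J"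
    and "\<And>w f. f \<in> J \<Longrightarrow> mon w * f \<in> J" "\<And>w f. f \<in> J \<Longrightarrow> f * mon w \<in> J"
  shows "closed_ideal J"
proof -
  have "r * f \<in> J \<and> f * r \<in> J" if "f \<in> J" for f r
    using that
    by (induction r rule: free_alg_induct)
      (simp_all add: assms distrib_left distrib_right mult.assoc scal_left_commute)
  with assms show ?thesis by (auto simp: closed_ideal_def)
qed

section \<open>Monomial ideals of the free algebra\<close>

definition factor :: "'n list \<Rightarrow> 'n list \<Rightarrow> bool" where
  "factor s w \<longleftrightarrow> (\<exists>u v. w = u @ s @ v)"

lemma factor_refl: "factor w w"
  unfolding factor_def by (metis append.left_neutral append.right_neutral)

lemma factor_trans: "factor u v \<Longrightarrow> factor v w \<Longrightarrow> factor u w"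
  unfolding factor_def by (metis append.assoc)

lemma factor_append: "factor s w \<Longrightarrow> factor s (u @ w @ v)"
  by (metis factor_def factor_trans)

lemma factor_mset: "factor s w \<Longrightarrow> mset s \<subseteq># mset w"
  unfolding factor_def by (auto simp: subseteq_mset_def add_ac)

lemma Idl_mon_eq:
  fixes S :: "'n list set"
  shows "Idl\<^bsub>T\<^esub> (mon ` S) = {f. \<forall>w\<in>keys f. \<exists>s\<in>S. factor s w}"
proof
  let ?J = "{f :: 'n free_alg. \<forall>w\<in>keys f. \<exists>s\<in>S. factor s w}"
  have "closed_ideal ?J"
  proof (rule closed_idealI_mon, goal_cases)
    case (2 f g)
    then show ?case using keys_add[of f g] by blast
  next
    case (3 c f)
    then show ?case by (auto simp: in_keys_iff lookup_scal_mult)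
  next
    case (4 w f)
    show ?case
    proof (intro CollectI ballI)
      fix x assume "x \<in> keys (mon w * f)"
      then obtain y where "y \<in> keys f" "x = w @ y"
        using keys_mult[of "mon w" f] by (auto simp: keys_mon plus_list_def)
      with 4 show "\<exists>s\<in>S. factor s x" using factor_append[of _ y w "[]"] by auto
    qed
  next
    case (5 w f)
    show ?case
    proof (intro CollectI ballI)
      fix x assume "x \<in> keys (f * mon w)"
      then obtain y where "y \<in> keys f" "x = y @ w"
        using keys_mult[of f "mon w"] by (auto simp: keys_mon plus_list_def)
      with 5 show "\<exists>s\<in>S. factor s x" using factor_append[of _ y "[]" w] by auto
    qed
  qed auto
  moreover have "mon ` S \<subseteq> ?J" by (auto simp: keys_mon intro: factor_refl)
  ultimately show "Idl\<^bsub>T\<^esub> (mon ` S) \<subseteq> ?J" by (rule Idl_least)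
  show "?J \<subseteq> Idl\<^bsub>T\<^esub> (mon ` S)"
  proof
    fix f assume f: "f \<in> ?J"
    have "mon w \<in> Idl\<^bsub>T\<^esub> (mon ` S)" if "w \<in> keys f" for w
    proof -
      from f that obtain s u v where "s \<in> S" "w = u @ s @ v" unfolding factor_def by blast
      moreover from this have "mon s \<in> Idl\<^bsub>T\<^esub> (mon ` S)" using Idl_superset by blast
      ultimately show ?thesis
        using closed_ideal_left closed_ideal_right closed_ideal_Idl by (metis mon_append)
    qed
    then have "lin_ext mon f \<in> Idl\<^bsub>T\<^esub> (mon ` S)" unfolding lin_ext_def
      by (intro closed_ideal_sum closed_ideal_Idl closed_ideal_left)
    then show "f \<in> Idl\<^bsub>T\<^esub> (mon ` S)" by (simp add: lin_ext_mon_id)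
  qed
qed

lemma mon_in_Idl_iff: "mon w \<in> Idl\<^bsub>T\<^esub> (mon ` S) \<longleftrightarrow> (\<exists>s\<in>S. factor s w)"
  by (simp add: Idl_mon_eq keys_mon)

text \<open>A word that is dropped from an antichain has none of the remaining words as a factor, so it is
  lost from the monomial ideal.\<close>

lemma minimally_generates_mon:
  assumes "Idl\<^bsub>T\<^esub> (mon ` S) = J"
    and antichain: "\<And>s t. s \<in> S \<Longrightarrow> t \<in> S \<Longrightarrow> factor s t \<Longrightarrow> s = t"
  shows "minimally_generates T (mon ` S) J"
  unfolding minimally_generates_def
proof (intro conjI allI impI assms(1))
  fix C assume C: "C \<subset> mon ` S"
  then obtain S' where S': "S' \<subseteq> S" "C = mon ` S'" by (meson psubset_imp_subset subset_image_iff)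
  with C obtain s where s: "s \<in> S" "s \<notin> S'" by blast
  with S' antichain have "mon s \<notin> Idl\<^bsub>T\<^esub> C" by (auto simp: mon_in_Idl_iff)
  moreover have "mon s \<in> J" using s assms(1) Idl_superset by blast
  ultimately show "Idl\<^bsub>T\<^esub> C \<noteq> J" by blast
qed

section \<open>The action of matrices\<close>

definition gen_image :: "complex ^ 'n ^ 'n \<Rightarrow> 'n \<Rightarrow> 'n::finite free_alg" where
  "gen_image g i = (\<Sum>l\<in>UNIV. scal (g $ l $ i) * X l)"

lemma act_eq_lin_ext: "act g = lin_ext (\<lambda>w. prod_list (map (gen_image g) w))"
  by (rule ext) (simp add: act_def lin_ext_def gen_image_def[abs_def])

lemmas act_add = lin_ext_add[of "\<lambda>w. prod_list (map (gen_image g) w)" for g, folded act_eq_lin_ext]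
lemmas act_scal = lin_ext_scal[of "\<lambda>w. prod_list (map (gen_image g) w)" for g, folded act_eq_lin_ext]
lemmas act_0 = lin_ext_0[of "\<lambda>w. prod_list (map (gen_image g) w)" for g, folded act_eq_lin_ext]
lemmas act_diff = lin_ext_diff[of "\<lambda>w. prod_list (map (gen_image g) w)" for g, folded act_eq_lin_ext]
lemmas act_sum = lin_ext_sum[of "\<lambda>w. prod_list (map (gen_image g) w)" for g, folded act_eq_lin_ext]
lemmas act_mon = lin_ext_mon[of "\<lambda>w. prod_list (map (gen_image g) w)" for g, folded act_eq_lin_ext]

lemma act_mult: "act g (f * h) = act g f * act g h"
proof (induction f arbitrary: h rule: free_alg_induct)
  case (mon c w)
  show ?case
  proof (induction h rule: free_alg_induct)
    case (mon d v)
    have "act g (mon (w @ v)) = act g (mon w) * act g (mon v)" by (simp add: act_mon)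
    then show ?case
      by (simp add: mult.assoc act_scal mon_append scal_left_commute[of "mon w"]
          scal_left_commute[of "act g (mon w)"])
  qed (simp add: act_add distrib_left)
qed (simp add: act_add distrib_right)

lemma act_X: "act g (X i) = gen_image g i"
  by (simp add: X_def act_mon)

lemma act_1: "act g 1 = 1"
  using act_mon[of g "[]"] by (simp add: mon_Nil)

lemma act_mon_Cons: "act g (mon (x # w)) = gen_image g x * act g (mon w)"
  by (simp add: act_mon)

lemma act_comp_X: "act g (act h (X i)) = act (g ** h) (X i)"
proof -
  have "act g (act h (X i)) = (\<Sum>k\<in>UNIV. scal (h $ k $ i) * (\<Sum>l\<in>UNIV. scal (g $ l $ k) * X l))"
    by (simp add: act_X gen_image_def[of h] act_sum act_scal) (simp add: gen_image_def)
  also have "\<dots> = (\<Sum>l\<in>UNIV. \<Sum>k\<in>UNIV. scal (g $ l $ k * h $ k $ i) * X l)"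
    unfolding sum_distrib_left
    by (subst sum.swap) (simp add: mult.assoc[symmetric] mult.commute flip: scal_mult)
  also have "\<dots> = (\<Sum>l\<in>UNIV. scal ((g ** h) $ l $ i) * X l)"
    by (simp add: matrix_matrix_mult_def free_alg.scale_sum_left)
  finally show ?thesis by (simp add: act_X gen_image_def)
qed

lemma act_comp: "act g (act h f) = act (g ** h) f"
proof (induction f rule: free_alg_induct)
  case (mon c w)
  have "act g (act h (mon w)) = act (g ** h) (mon w)"
    by (induction w) (simp_all add: act_mult mon_Cons act_comp_X mon_Nil act_1)
  then show ?case by (simp add: act_scal)
qed (simp add: act_add)

lemma act_mat_1: "act (mat 1) f = f"
proof (induction f rule: free_alg_induct)
  case (mon c w)
  have "gen_image (mat 1) i = X i" for i :: 'a
  proof -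
    have "gen_image (mat 1) i = (\<Sum>l\<in>UNIV. if l = i then X l else 0)"
      unfolding gen_image_def by (rule sum.cong) (auto simp: mat_def scal_0 scal_1)
    then show ?thesis by simp
  qed
  then have "act (mat 1) (mon w) = mon w"
    by (induction w) (simp_all add: act_mult mon_Cons act_X mon_Nil act_1)
  then show ?case by (simp add: act_scal)
qed (simp add: act_add)

lemma GL_inverse:
  assumes "g \<in> GL"
  obtains h where "h \<in> GL" "g ** h = mat 1" "h ** g = mat 1"
  using assms unfolding GL_def invertible_def by blast

lemma lookup_act_mon_Cons:
  "lookup (act g (mon (x # v))) w =
     (case w of [] \<Rightarrow> 0 | y # ys \<Rightarrow> g $ y $ x * lookup (act g (mon v)) ys)"
proof -
  have "lookup (act g (mon (x # v))) w =
      (\<Sum>l\<in>UNIV. g $ l $ x * lookup (X l * act g (mon v)) w)"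
    by (simp add: act_mon_Cons gen_image_def sum_distrib_right mult.assoc lookup_sum lookup_scal_mult)
  also have "\<dots> = (case w of [] \<Rightarrow> 0 | y # ys \<Rightarrow> g $ y $ x * lookup (act g (mon v)) ys)"
  proof (cases w)
    case (Cons y ys)
    have "(\<Sum>l\<in>UNIV. g $ l $ x * lookup (X l * act g (mon v)) w) =
        (\<Sum>l\<in>UNIV. if y = l then g $ l $ x * lookup (act g (mon v)) ys else 0)"
      by (rule sum.cong) (auto simp: Cons lookup_X_mult)
    then show ?thesis by (simp add: Cons)
  qed (simp add: lookup_X_mult)
  finally show ?thesis .
qed

lemma lookup_act_mon_Nil: "lookup (act g (mon [])) w = (if w = [] then 1 else 0)"
  using lookup_mon[of "[]" w] by (auto simp: mon_Nil act_1)

lemma lookup_act_mon_length: "length v \<noteq> length w \<Longrightarrow> lookup (act g (mon v)) w = 0"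
  by (induction v arbitrary: w) (auto simp: lookup_act_mon_Cons lookup_act_mon_Nil split: list.splits)

lemma lookup_act: "lookup (act g f) w = (\<Sum>v\<in>keys f. lookup f v * lookup (act g (mon v)) w)"
  by (simp add: act_eq_lin_ext lin_ext_mon lookup_lin_ext[of _ f])

section \<open>Polynomial functions of a matrix\<close>

lemma matrix_polynomial_sum:
  "(\<And>x. x \<in> A \<Longrightarrow> matrix_polynomial (h x)) \<Longrightarrow> matrix_polynomial (\<lambda>g. \<Sum>x\<in>A. h x g)"
  by (induction A rule: infinite_finite_induct) (auto intro: matrix_polynomial.intros)

lemma matrix_polynomial_prod:
  "(\<And>x. x \<in> A \<Longrightarrow> matrix_polynomial (h x)) \<Longrightarrow> matrix_polynomial (\<lambda>g. \<Prod>x\<in>A. h x g)"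
  by (induction A rule: infinite_finite_induct) (auto intro: matrix_polynomial.intros)

lemma matrix_polynomial_det: "matrix_polynomial (det :: complex ^ 'n ^ 'n \<Rightarrow> complex)"
  unfolding det_def[abs_def]
  by (intro matrix_polynomial_sum matrix_polynomial.mult matrix_polynomial.const
      matrix_polynomial_prod matrix_polynomial.entry)

lemma matrix_polynomial_act_mon: "matrix_polynomial (\<lambda>g. lookup (act g (mon v)) w)"
proof (induction v arbitrary: w)
  case Nil
  show ?case by (simp add: lookup_act_mon_Nil matrix_polynomial.const)
next
  case (Cons x v)
  then show ?case
    by (cases w) (auto simp: lookup_act_mon_Cons intro: matrix_polynomial.intros)
qed

lemma matrix_polynomial_act: "matrix_polynomial (\<lambda>g. lookup (act g f) w)"
proof -
  have "(\<lambda>g. lookup (act g f) w) = (\<lambda>g. \<Sum>v\<in>keys f. lookup f v * lookup (act g (mon v)) w)"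
    by (rule ext) (rule lookup_act)
  then show ?thesis
    by (auto intro!: matrix_polynomial_sum matrix_polynomial.mult matrix_polynomial.const
        matrix_polynomial_act_mon)
qed

lemma matrix_polynomial_continuous: "matrix_polynomial p \<Longrightarrow> continuous_on UNIV p"
  by (induction rule: matrix_polynomial.induct)
    (auto intro!: continuous_intros)

text \<open>Restricted to a complex line, a polynomial in the entries becomes a polynomial in one variable,
  so its zero set contains the line or meets it in finitely many points.\<close>

lemma matrix_polynomial_line:
  assumes "matrix_polynomial p"
  shows "\<exists>r. \<forall>z. p (\<chi> k l. a $ k $ l + z * b $ k $ l) = poly r z"
  using assms
proof (induction rule: matrix_polynomial.induct)
  case (const c)
  show ?case by (rule exI[of _ "[:c:]"]) simp
next
  case (entry i j)
  show ?case by (rule exI[of _ "[:a $ i $ j, b $ i $ j:]"]) simp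
next
  case (add p q)
  then obtain r s where "\<forall>z. p (\<chi> k l. a $ k $ l + z * b $ k $ l) = poly r z"
    "\<forall>z. q (\<chi> k l. a $ k $ l + z * b $ k $ l) = poly s z" by blast
  then show ?case by (intro exI[of _ "r + s"]) simp
next
  case (mult p q)
  then obtain r s where "\<forall>z. p (\<chi> k l. a $ k $ l + z * b $ k $ l) = poly r z"
    "\<forall>z. q (\<chi> k l. a $ k $ l + z * b $ k $ l) = poly s z" by blast
  then show ?case by (intro exI[of _ "r * s"]) simp
qed

text \<open>Join \<open>h\<close> to a point where \<open>p\<close> does not vanish by a complex line: the zeros of \<open>p\<close> on it are
  isolated, so \<open>h\<close> is a limit of points where \<open>p\<close> does not vanish.\<close>

lemma matrix_polynomial_dense:
  fixes p :: "complex ^ 'n ^ 'n \<Rightarrow> complex"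
  assumes p: "matrix_polynomial p" and g: "p g \<noteq> 0"
  shows "h \<in> closure {x. p x \<noteq> 0}"
proof -
  define c where "c z = (\<chi> k l. h $ k $ l + z * (g - h) $ k $ l)" for z :: complex
  obtain r where r: "p (c z) = poly r z" for z
    using matrix_polynomial_line[OF p, of h "g - h"] unfolding c_def by blast
  have "c 1 = g" by (simp add: c_def vec_eq_iff)
  with g r[of 1] have "r \<noteq> 0" by auto
  then have "finite {z. poly r z = 0}" by (rule poly_roots_finite)
  then have "open (- ({z. poly r z = 0} - {0}))"
    by (intro open_Compl finite_imp_closed finite_Diff)
  then have "\<forall>\<^sub>F z in at 0. poly r z \<noteq> 0"
    unfolding eventually_at_topological
    by (intro exI[of _ "- ({z. poly r z = 0} - {0})"]) auto
  then have "\<forall>\<^sub>F z in at 0. c z \<in> closure {x. p x \<noteq> 0}"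
    using closure_subset[of "{x. p x \<noteq> 0}"] by (auto simp: r[symmetric] elim!: eventually_mono)
  moreover have "(c \<longlongrightarrow> c 0) (at 0)"
    unfolding c_def by (intro tendsto_intros)
  ultimately have "c 0 \<in> closure {x. p x \<noteq> 0}"
    using Lim_in_closed_set[of "closure {x. p x \<noteq> 0}" c "at 0" "c 0"] by simp
  moreover have "c 0 = h" by (simp add: c_def vec_eq_iff)
  ultimately show ?thesis by simp
qed

text \<open>Countably many non-zero polynomials have a common non-zero, by the Baire category theorem.\<close>

lemma generic_matrix:
  fixes P :: "(complex ^ 'n ^ 'n \<Rightarrow> complex) set"
  assumes "countable P" "\<And>p. p \<in> P \<Longrightarrow> matrix_polynomial p" "\<And>p. p \<in> P \<Longrightarrow> \<exists>g. p g \<noteq> 0"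
  obtains g where "\<And>p. p \<in> P \<Longrightarrow> p g \<noteq> 0"
proof -
  let ?G = "(\<lambda>p. {x. p x \<noteq> 0}) ` P"
  have "UNIV \<subseteq> closure (\<Inter>?G)"
  proof (rule Baire)
    show "countable ?G" using assms(1) by simp
    fix S assume "S \<in> ?G"
    then obtain p where p: "p \<in> P" "S = {x. p x \<noteq> 0}" by blast
    have "open S"
      using open_Collect_neq[OF matrix_polynomial_continuous[OF assms(2)[OF p(1)]], of "\<lambda>_. 0"]
      by (simp add: p(2))
    moreover have "UNIV \<subseteq> closure S"
    proof
      fix x
      obtain g where "p g \<noteq> 0" using assms(3) p(1) by blast
      then show "x \<in> closure S" unfolding p(2) by (rule matrix_polynomial_dense[OF assms(2)[OF p(1)]])
    qed
    ultimately show "openin (top_of_set UNIV) S \<and> UNIV \<subseteq> closure S"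
      by (simp add: openin_open_eq)
  qed simp
  then have "\<Inter>?G \<noteq> {}" by auto
  then show ?thesis using that by blast
qed

lemma det_nonzero_iff_GL: "g \<in> GL \<longleftrightarrow> det g \<noteq> 0"
  by (simp add: GL_def invertible_det_nz)

lemma generic_matrix_GL:
  fixes P :: "(complex ^ 'n ^ 'n \<Rightarrow> complex) set"
  assumes "countable P" "\<And>p. p \<in> P \<Longrightarrow> matrix_polynomial p" "\<And>p. p \<in> P \<Longrightarrow> \<exists>g. p g \<noteq> 0"
  obtains g where "g \<in> GL" "\<And>p. p \<in> P \<Longrightarrow> p g \<noteq> 0"
proof -
  have nz: "\<exists>g. p g \<noteq> 0" if "p \<in> insert det P" for p
    using that assms(3) det_I by (auto intro: exI[of _ "mat 1"])
  show ?thesis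
  proof (rule generic_matrix)
    show "countable (insert det P)" using assms(1) by simp
    show "matrix_polynomial p" if "p \<in> insert det P" for p
      using that assms(2) matrix_polynomial_det by auto
    fix g assume g: "\<And>p. p \<in> insert det P \<Longrightarrow> p g \<noteq> 0"
    show ?thesis by (rule that[of g]) (use g in \<open>auto simp: det_nonzero_iff_GL\<close>)
  qed (rule nz)
qed

text \<open>This makes generic initial ideals unique: any two countable families of open sets on whose
  intersections the initial ideal is constant have a matrix in common.\<close>

lemma zariski_open_Inter_nonempty:
  fixes \<U> :: "(complex ^ 'n ^ 'n) set set"
  assumes "countable \<U>" "\<And>U. U \<in> \<U> \<Longrightarrow> zariski_open U \<and> U \<noteq> {}"
  shows "GL \<inter> \<Inter>\<U> \<noteq> {}"
proof -
  have "\<exists>p. matrix_polynomial p \<and> (\<exists>g. p g \<noteq> 0) \<and> {g \<in> GL. p g \<noteq> 0} \<subseteq> U" if U: "U \<in> \<U>" for U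
    using assms(2)[OF U] unfolding zariski_open_def by auto
  then have "\<forall>U\<in>\<U>. \<exists>p. matrix_polynomial p \<and> (\<exists>g. p g \<noteq> 0) \<and> {g \<in> GL. p g \<noteq> 0} \<subseteq> U"
    by blast
  then obtain p where p: "\<forall>U\<in>\<U>. matrix_polynomial (p U) \<and> (\<exists>g. p U g \<noteq> 0) \<and>
      {g \<in> GL. p U g \<noteq> 0} \<subseteq> U"
    by (rule bchoice[THEN exE])
  obtain g where "g \<in> GL" "\<And>r. r \<in> p ` \<U> \<Longrightarrow> r g \<noteq> 0"
  proof (rule generic_matrix_GL)
    show "countable (p ` \<U>)" using assms(1) by simp
  qed (use p in auto)
  with p show ?thesis by blast
qed

section \<open>Derivatives along a one-parameter group\<close>

text \<open>For distinct \<open>i\<close> and \<open>j\<close> these matrices form the one-parameter group acting by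
  $X_j \mapsto X_j + t X_i$, all other variables being fixed.\<close>

definition transvection :: "'n \<Rightarrow> 'n \<Rightarrow> complex \<Rightarrow> complex ^ 'n ^ 'n" where
  "transvection i j t = (\<chi> k l. (if k = l then 1 else 0) + (if k = i \<and> l = j then t else 0))"

lemma transvection_mult:
  fixes g :: "complex ^ 'n ^ 'n"
  shows "transvection i j t ** g = (\<chi> k l. g $ k $ l + (if k = i then t * g $ j $ l else 0))"
proof -
  have "(\<Sum>x\<in>UNIV. transvection i j t $ k $ x * g $ x $ l) =
      (\<Sum>x\<in>UNIV. (if k = x then g $ x $ l else 0) + (if x = j then if k = i then t * g $ j $ l else 0 else 0))"
    for k l
    by (rule sum.cong) (auto simp: transvection_def distrib_right)
  then show ?thesis by (simp add: matrix_matrix_mult_def vec_eq_iff sum.distrib)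
qed

lemma transvection_inverse:
  fixes g :: "complex ^ 'n ^ 'n"
  assumes "i \<noteq> j"
  shows "transvection i j t ** (transvection i j (- t) ** g) = g"
  using assms by (auto simp: transvection_mult vec_eq_iff)

lemma transvection_0: "transvection i j 0 = mat 1"
  by (simp add: transvection_def mat_def vec_eq_iff)

text \<open>Left multiplication by a transvection changes the entries linearly in \<open>t\<close>, so differentiating
  along the group maps polynomials to polynomials.\<close>

lemma matrix_polynomial_derivative:
  fixes p :: "complex ^ 'n ^ 'n \<Rightarrow> complex"
  assumes "matrix_polynomial p"
  shows "\<exists>p'. matrix_polynomial p' \<and>
    (\<forall>g. ((\<lambda>t. p (transvection i j (- t) ** g)) has_field_derivative p' g) (at 0))"
  using assms
proof (induction rule: matrix_polynomial.induct)
  case (const c)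
  show ?case
    by (rule exI[of _ "\<lambda>_. 0"]) (auto intro: matrix_polynomial.intros)
next
  case (entry k l)
  show ?case
  proof (intro exI[of _ "\<lambda>g. (if k = i then - 1 else 0) * g $ j $ l"] conjI allI)
    show "matrix_polynomial (\<lambda>g :: complex ^ 'n ^ 'n. (if k = i then - 1 else 0) * g $ j $ l)"
      by (intro matrix_polynomial.intros)
    show "((\<lambda>t. (transvection i j (- t) ** g) $ k $ l) has_field_derivative
      (if k = i then - 1 else 0) * g $ j $ l) (at 0)" for g :: "complex ^ 'n ^ 'n"
      by (auto simp: transvection_mult intro!: derivative_eq_intros)
  qed
next
  case (add p q)
  then obtain p' q' where "matrix_polynomial p'" "matrix_polynomial q'"
    "\<forall>g. ((\<lambda>t. p (transvection i j (- t) ** g)) has_field_derivative p' g) (at 0)"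
    "\<forall>g. ((\<lambda>t. q (transvection i j (- t) ** g)) has_field_derivative q' g) (at 0)" by blast
  then show ?case
    by (intro exI[of _ "\<lambda>g. p' g + q' g"])
      (auto intro: matrix_polynomial.intros intro!: DERIV_add)
next
  case (mult p q)
  then obtain p' q' where *: "matrix_polynomial p'" "matrix_polynomial q'"
    "\<forall>g. ((\<lambda>t. p (transvection i j (- t) ** g)) has_field_derivative p' g) (at 0)"
    "\<forall>g. ((\<lambda>t. q (transvection i j (- t) ** g)) has_field_derivative q' g) (at 0)" by blast
  show ?case
  proof (intro exI[of _ "\<lambda>g. p' g * q g + q' g * p g"] conjI allI)
    show "matrix_polynomial (\<lambda>g. p' g * q g + q' g * p g)"
      using * mult by (auto intro: matrix_polynomial.intros)
    fix g
    show "((\<lambda>t. p (transvection i j (- t) ** g) * q (transvection i j (- t) ** g))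
      has_field_derivative p' g * q g + q' g * p g) (at 0)"
      using DERIV_mult[OF *(3)[rule_format, of g] *(4)[rule_format, of g]]
      by (simp add: transvection_0 matrix_mul_lid)
  qed
qed

text \<open>The words obtained by replacing one occurrence of \<open>j\<close> by \<open>i\<close>, with multiplicity. They describe
  the derivation that maps $X_j$ to $X_i$ and the other variables to zero, which is the derivative
  of the group of transvections at the identity (lemma \<open>derivative_act_mon\<close>).\<close>

fun replace_one :: "'n \<Rightarrow> 'n \<Rightarrow> 'n list \<Rightarrow> 'n list list" where
  "replace_one i j [] = []"
| "replace_one i j (x # w) = (if x = j then [i # w] else []) @ map ((#) x) (replace_one i j w)"

lemma replace_one_Nil: "j \<notin> set w \<Longrightarrow> replace_one i j w = []"
  by (induction w) auto

lemma mset_replace_one: "v \<in> set (replace_one i j w) \<Longrightarrow> mset v = add_mset i (mset w - {#j#})"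
proof (induction w arbitrary: v)
  case (Cons x w)
  consider "x = j" "v = i # w" | v' where "v = x # v'" "v' \<in> set (replace_one i j w)"
    using Cons.prems by (auto split: if_splits)
  then show ?case
  proof cases
    case (2 v')
    then have "j \<in> set w" using replace_one_Nil[of j w i] by (cases "j \<in> set w") auto
    with 2 Cons.IH[of v'] show ?thesis by auto
  qed auto
qed simp

lemma length_replace_one: "length (replace_one i j w) = count (mset w) j"
  by (induction w) auto

lemma derivative_act_mon:
  fixes w v :: "'n::finite list"
  shows "((\<lambda>t. lookup (act (transvection i j t) (mon w)) v) has_field_derivative
     of_nat (count_list (replace_one i j w) v)) (at 0)"
proof (induction w arbitrary: v)
  case Nil
  show ?case by (simp add: lookup_act_mon_Nil)
next
  case (Cons x w)
  show ?case
  proof (cases v)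
    case (Cons y ys)
    have 1: "((\<lambda>t. transvection i j t $ y $ x) has_field_derivative
        (if y = i \<and> x = j then 1 else 0)) (at 0)"
    proof (cases "y = i \<and> x = j")
      case True
      then show ?thesis by (auto simp: transvection_def intro!: derivative_eq_intros)
    next
      case False
      then have "(\<lambda>t. transvection i j t $ y $ x) = (\<lambda>_. if y = x then 1 else 0)"
        by (auto simp: transvection_def)
      then show ?thesis unfolding if_not_P[OF False] by simp
    qed
    have 2: "lookup (act (transvection i j 0) (mon w)) ys = (if w = ys then 1 else 0)"
      by (simp add: transvection_0 act_mat_1 lookup_mon)
    have 3: "transvection i j 0 $ y $ x = (if y = x then 1 else 0)"
      by (simp add: transvection_def)
    have 4: "count_list (map ((#) x) l) (y # ys) = (if x = y then count_list l ys else 0)" for l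
      by (induction l) auto
    show ?thesis
    proof -
      have "complex_of_nat (count_list (replace_one i j (x # w)) v) =
          (if y = i \<and> x = j then 1 else 0) * (if w = ys then 1 else 0) +
          of_nat (count_list (replace_one i j w) ys) * (if y = x then 1 else 0)"
        by (auto simp: Cons 4)
      then show ?thesis
        using DERIV_mult[OF 1 Cons.IH[of ys]] unfolding 2 3
        by (simp only: Cons lookup_act_mon_Cons list.case)
    qed
  next
    case Nil
    have "count_list (map ((#) x) l) [] = 0" for l :: "'n list list"
      by (induction l) auto
    with Nil show ?thesis by (simp add: lookup_act_mon_Cons)
  qed
qed

section \<open>Normal forms modulo the quadratic relations\<close>

definition words :: "nat \<Rightarrow> 'n list set" where
  "words d = {w. length w = d}"

lemma diff_add_cancel_middle: "(a - b) + (b - c) = a - (c :: 'a :: ab_group_add)"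
  by simp

lemma finite_words: "finite (words d :: 'n::finite list set)"
  using finite_lists_length_eq[of "UNIV :: 'n set" d] by (simp add: words_def)

lemma sort_eq_iff: "sort u = sort v \<longleftrightarrow> mset u = mset v"
  by (metis mset_sort properties_for_sort sorted_sort)

lemma sorted_mset_eqD: "sorted u \<Longrightarrow> sorted v \<Longrightarrow> mset u = mset v \<Longrightarrow> u = v"
  by (metis properties_for_sort)

text \<open>The parameter is \<open>1\<close> for the symmetric and \<open>- 1\<close> for the exterior algebra. The last assumption
  says that \<open>I\<close> is the smallest ideal containing the relations. It is stated as a minimality
  property because the two generating sets in the definitions of the ideals have different forms.\<close>

locale quadratic_quotient =
  fixes q :: complex and I :: "'n::{finite,linorder} free_alg set"
  assumes q: "q = 1 \<or> q = - 1"
    and closed_I: "closed_ideal I"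
    and rel_in_I: "\<And>i j. i < j \<Longrightarrow> X i * X j - scal q * (X j * X i) \<in> I"
    and square_in_I: "\<And>i. q = - 1 \<Longrightarrow> X i * X i \<in> I"
    and I_least: "\<And>K. closed_ideal K \<Longrightarrow> (\<And>i j. i < j \<Longrightarrow> X i * X j - scal q * (X j * X i) \<in> K) \<Longrightarrow>
      (\<And>i. q = - 1 \<Longrightarrow> X i * X i \<in> K) \<Longrightarrow> I \<subseteq> K"
begin

lemma q_square: "q * q = 1"
  using q by auto

lemma q_nonzero: "q \<noteq> 0"
  using q by auto

text \<open>The factor contributed by two letters to the coefficient of a word when the word is sorted: letters
  out of order are exchanged at the price of \<open>q\<close>, and equal letters annihilate the word if they
  anticommute.\<close>

definition pair_sign :: "'n \<Rightarrow> 'n \<Rightarrow> complex" where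
  "pair_sign x y = (if x < y then 1 else if y < x then q else if q = 1 then 1 else 0)"

primrec word_sign :: "'n list \<Rightarrow> complex" where
  "word_sign [] = 1"
| "word_sign (x # w) = prod_list (map (pair_sign x) w) * word_sign w"

text \<open>The increasing words that represent the monomials of the quotient: weakly increasing for
  \<open>q = 1\<close>, strictly increasing for \<open>q = - 1\<close>.\<close>

definition std :: "'n list \<Rightarrow> bool" where
  "std w \<longleftrightarrow> sorted w \<and> word_sign w \<noteq> 0"

definition nf :: "'n free_alg \<Rightarrow> 'n free_alg" where
  "nf = lin_ext (\<lambda>w. scal (word_sign w) * mon (sort w))"

lemma prod_pair_sign_1: "(\<And>y. y \<in> set w \<Longrightarrow> pair_sign x y = 1) \<Longrightarrow> prod_list (map (pair_sign x) w) = 1"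
  by (induction w) auto

lemma word_sign_sym:
  assumes "q = 1"
  shows "word_sign w = 1"
proof (induction w)
  case (Cons x w)
  have "pair_sign x y = 1" for y unfolding pair_sign_def using assms by auto
  with Cons show ?case by (simp add: prod_pair_sign_1)
qed simp

lemma word_sign_nonzero_iff: "word_sign w \<noteq> 0 \<longleftrightarrow> q = 1 \<or> distinct w"
  using q_nonzero by (induction w) (auto simp: prod_list_zero_iff pair_sign_def split: if_splits)

lemma word_sign_sorted: "sorted w \<Longrightarrow> word_sign w \<noteq> 0 \<Longrightarrow> word_sign w = 1"
proof (induction w)
  case (Cons x w)
  have "q = 1 \<or> distinct (x # w)"
    using word_sign_nonzero_iff[of "x # w"] Cons.prems by blast
  then have "pair_sign x y = 1" if "y \<in> set w" for y
    using that Cons.prems(1) by (auto simp: pair_sign_def)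
  with Cons show ?case by (simp add: prod_pair_sign_1)
qed simp

lemma word_sign_std: "std w \<Longrightarrow> word_sign w = 1"
  by (simp add: std_def word_sign_sorted)

lemma word_sign_submset:
  "mset v \<subseteq># mset w \<Longrightarrow> word_sign w \<noteq> 0 \<Longrightarrow> word_sign v \<noteq> 0"
proof (cases "q = 1")
  case False
  assume vw: "mset v \<subseteq># mset w" and "word_sign w \<noteq> 0"
  with False have w: "distinct w" by (simp add: word_sign_nonzero_iff)
  have "count (mset v) a = (if a \<in> set v then 1 else 0)" for a
  proof -
    have "count (mset w) a \<le> 1" using w by (simp add: distinct_count_atmost_1)
    with mset_subset_eq_count[OF vw, of a] have "count (mset v) a \<le> 1" by linarith
    moreover have "0 < count (mset v) a \<longleftrightarrow> a \<in> set v" by simp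
    ultimately show ?thesis by (cases "count (mset v) a") (auto simp del: count_greater_zero_iff)
  qed
  then have "distinct v" by (simp add: distinct_count_atmost_1)
  then show ?thesis by (simp add: word_sign_nonzero_iff)
qed (unfold word_sign_nonzero_iff, blast)

lemma word_sign_mset: "mset v = mset w \<Longrightarrow> word_sign w \<noteq> 0 \<Longrightarrow> word_sign v \<noteq> 0"
  by (rule word_sign_submset) auto

lemma std_sort: "word_sign w \<noteq> 0 \<Longrightarrow> std (sort w)"
  using word_sign_mset[of "sort w" w] by (simp add: std_def)

lemma sort_std: "std w \<Longrightarrow> sort w = w"
  by (simp add: std_def sorted_sort_id)

lemma std_mset_inj: "std v \<Longrightarrow> std w \<Longrightarrow> mset v = mset w \<Longrightarrow> v = w"
  by (simp add: std_def sorted_mset_eqD)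

lemma word_sign_swap:
  assumes "x < y"
  shows "word_sign (u @ y # x # v) = q * word_sign (u @ x # y # v)"
  using assms by (induction u) (auto simp: pair_sign_def mult_ac)

lemmas nf_add = lin_ext_add[of "\<lambda>w. scal (word_sign w) * mon (sort w)", folded nf_def]
lemmas nf_scal = lin_ext_scal[of "\<lambda>w. scal (word_sign w) * mon (sort w)", folded nf_def]
lemmas nf_0 = lin_ext_0[of "\<lambda>w. scal (word_sign w) * mon (sort w)", folded nf_def]
lemmas nf_diff = lin_ext_diff[of "\<lambda>w. scal (word_sign w) * mon (sort w)", folded nf_def]
lemmas nf_mon = lin_ext_mon[of "\<lambda>w. scal (word_sign w) * mon (sort w)", folded nf_def]
lemmas nf_sum = lin_ext_sum[of "\<lambda>w. scal (word_sign w) * mon (sort w)", folded nf_def]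

lemma nf_mon_std: "std w \<Longrightarrow> nf (mon w) = mon w"
  by (simp add: nf_mon word_sign_std sort_std scal_1)

text \<open>Exchanging two neighbouring letters of a word multiplies its coefficient by \<open>q\<close>, and
  $q^2 = 1$, so a relation is mapped to zero in every context of words. Quantifying over the contexts
  is what turns the kernel condition into an ideal.\<close>

lemma nf_I:
  assumes "f \<in> I"
  shows "nf f = 0"
proof -
  let ?K = "{f. \<forall>u v. nf (mon u * f * mon v) = 0}"
  have "I \<subseteq> ?K"
  proof (rule I_least)
    show "closed_ideal ?K"
    proof (rule closed_idealI_mon, goal_cases)
      case (3 c f)
      have "mon u * (scal c * f) * mon v = scal c * (mon u * f * mon v)" for u v
        by (simp only: scal_left_commute mult.assoc)
      with 3 show ?case by (simp add: nf_scal)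
    next
      case (4 w f)
      have "mon u * (mon w * f) * mon v = mon (u @ w) * f * mon v" for u v
        by (simp add: mon_append mult.assoc)
      with 4 show ?case by simp
    next
      case (5 w f)
      have "mon u * (f * mon w) * mon v = mon u * f * mon (w @ v)" for u v
        by (simp add: mon_append mult.assoc)
      with 5 show ?case by simp
    qed (simp_all add: nf_0 nf_add distrib_left distrib_right)
  next
    fix i j :: 'n assume ij: "i < j"
    have "nf (mon u * (X i * X j - scal q * (X j * X i)) * mon v) = 0" for u v
    proof -
      have "mon u * (X i * X j - scal q * (X j * X i)) * mon v =
          mon (u @ i # j # v) - scal q * mon (u @ j # i # v)"
        by (simp add: mon_append mon_Cons algebra_simps scal_left_commute[of "mon u"])
      moreover have "sort (u @ j # i # v) = sort (u @ i # j # v)"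
        by (simp add: sort_eq_iff)
      ultimately show ?thesis
        using q_square
        by (simp add: nf_diff nf_scal nf_mon word_sign_swap[OF ij])
    qed
    then show "X i * X j - scal q * (X j * X i) \<in> ?K" by simp
  next
    fix i assume "q = - 1"
    then have "word_sign (u @ i # i # v) = 0" for u v
      using word_sign_nonzero_iff[of "u @ i # i # v"] by auto
    moreover have "mon u * (X i * X i) * mon v = mon (u @ i # i # v)" for u v
      by (simp add: mon_append mon_Cons mult.assoc)
    ultimately show "X i * X i \<in> ?K" by (simp add: nf_mon scal_0)
  qed
  with assms have "nf (mon [] * f * mon []) = 0" by blast
  then show ?thesis by (simp add: mon_Nil)
qed

lemma mon_pair_in_I: "mon (x # y # s) - scal (pair_sign x y) * mon (y # x # s) \<in> I" if "\<not> x < y"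
proof -
  have "X x * X y - scal (pair_sign x y) * (X y * X x) \<in> I"
  proof (cases "y < x")
    case True
    have "X x * X y - scal q * (X y * X x) = scal (- q) * (X y * X x - scal q * (X x * X y))"
      using q_square
      by (simp add: right_diff_distrib mult.assoc[symmetric] scal_minus_1 flip: scal_mult)
    moreover have "pair_sign x y = q" using True unfolding pair_sign_def by auto
    ultimately show ?thesis
      using closed_ideal_left[OF closed_I rel_in_I[OF True], of "scal (- q)"] by simp
  next
    case False
    with that have "y = x" by auto
    then show ?thesis
      using q square_in_I[of x] closed_ideal_0[OF closed_I] by (auto simp: pair_sign_def scal_1 scal_0)
  qed
  from closed_ideal_right[OF closed_I this, of "mon s"] show ?thesis
    by (simp add: mon_Cons left_diff_distrib mult.assoc)
qed

text \<open>One step of insertion sort: moving \<open>x\<close> to its place costs the pair signs of \<open>x\<close> with the letters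
  it passes, and the signs with the letters it does not pass are \<open>1\<close>, unless the word is zero in
  the quotient.\<close>

lemma mon_insort_in_I:
  "sorted s \<Longrightarrow> mon (x # s) - scal (prod_list (map (pair_sign x) s)) * mon (insort x s) \<in> I"
proof (induction s)
  case Nil
  show ?case using closed_ideal_0[OF closed_I] by (simp add: scal_1)
next
  case (Cons y s)
  consider "x < y" | "x = y" "q = - 1" | "x = y" "q = 1" | "y < x" using q by fastforce
  then show ?case
  proof cases
    case 1
    have "prod_list (map (pair_sign x) (y # s)) = 1"
      by (rule prod_pair_sign_1) (use 1 Cons.prems in \<open>auto simp: pair_sign_def\<close>)
    moreover have "insort x (y # s) = x # y # s" using 1 by auto
    ultimately show ?thesis
      using closed_ideal_0[OF closed_I] by (simp only: scal_1 mult_1_left diff_self)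
  next
    case 2
    then have "mon (x # y # s) \<in> I"
      using closed_ideal_right[OF closed_I square_in_I, of x "mon s"] by (simp add: mon_Cons mult.assoc)
    moreover have "pair_sign x y = 0" using 2 unfolding pair_sign_def by auto
    ultimately show ?thesis by (simp add: scal_0)
  next
    case 3
    have "prod_list (map (pair_sign x) (y # s)) = 1"
      using word_sign_sym[OF 3(2), of "x # y # s"] word_sign_sym[OF 3(2), of "y # s"] by simp
    moreover have "insort x (y # s) = x # y # s" using 3 by simp
    ultimately show ?thesis
      using closed_ideal_0[OF closed_I] by (simp only: scal_1 mult_1_left diff_self)
  next
    case 4
    let ?p = "prod_list (map (pair_sign x) s)"
    have "mon (x # y # s) - scal (pair_sign x y) * mon (y # x # s) \<in> I"
      using mon_pair_in_I[of x y s] 4 by auto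
    moreover have "scal (pair_sign x y) * (X y * (mon (x # s) - scal ?p * mon (insort x s))) \<in> I"
      using Cons by (intro closed_ideal_left closed_I) auto
    ultimately have "mon (x # y # s) - scal (pair_sign x y) * mon (y # x # s) +
        scal (pair_sign x y) * (X y * (mon (x # s) - scal ?p * mon (insort x s))) \<in> I"
      by (rule closed_ideal_add[OF closed_I])
    also have "mon (x # y # s) - scal (pair_sign x y) * mon (y # x # s) +
        scal (pair_sign x y) * (X y * (mon (x # s) - scal ?p * mon (insort x s))) =
        mon (x # y # s) - scal (pair_sign x y * ?p) * mon (y # insort x s)"
      unfolding mon_Cons[of y] right_diff_distrib scal_left_commute[of "X y"] scal_mult mult.assoc
      by (rule diff_add_cancel_middle)
    finally show ?thesis using 4 by auto
  qed
qed

lemma mon_minus_nf_in_I: "mon w - nf (mon w) \<in> I"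
proof (induction w)
  case Nil
  show ?case using closed_ideal_0[OF closed_I] by (simp add: nf_mon scal_1)
next
  case (Cons x w)
  have "X x * (mon w - nf (mon w)) +
      scal (word_sign w) * (mon (x # sort w) -
        scal (prod_list (map (pair_sign x) (sort w))) * mon (insort x (sort w))) \<in> I"
    using Cons mon_insort_in_I[of "sort w" x]
    by (intro closed_ideal_add closed_I closed_ideal_left) auto
  moreover have "prod_list (map (pair_sign x) (sort w)) = prod_list (map (pair_sign x) w)"
    by (metis mset_map mset_sort prod_mset_prod_list)
  moreover have "nf (mon (x # w)) =
      scal (word_sign w) * (scal (prod_list (map (pair_sign x) w)) * mon (insort x (sort w)))"
  proof -
    have "word_sign (x # w) = word_sign w * prod_list (map (pair_sign x) w)" by simp
    moreover have "sort (x # w) = insort x (sort w)" by simp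
    ultimately show ?thesis by (simp only: nf_mon scal_mult mult.assoc)
  qed
  ultimately show ?case
    unfolding nf_mon[of w] mon_Cons[of x w] mon_Cons[of x "sort w"] right_diff_distrib
      scal_left_commute[of "X x"]
    by (simp only: diff_add_cancel_middle)
qed

lemma minus_nf_in_I: "f - nf f \<in> I"
proof (induction f rule: free_alg_induct)
  case (mon c w)
  show ?case
    using closed_ideal_left[OF closed_I mon_minus_nf_in_I[of w], of "scal c"]
    by (simp add: nf_scal right_diff_distrib)
next
  case (add f g)
  have "(f - nf f) + (g - nf g) \<in> I" by (rule closed_ideal_add[OF closed_I add])
  then show ?case by (simp add: nf_add algebra_simps)
qed

lemma nf_eq_iff: "nf f = nf h \<longleftrightarrow> f - h \<in> I"
proof
  assume "nf f = nf h"
  moreover have "(f - nf f) - (h - nf h) \<in> I"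
    by (rule closed_ideal_diff[OF closed_I minus_nf_in_I minus_nf_in_I])
  ultimately show "f - h \<in> I" by simp
next
  assume "f - h \<in> I"
  then have "nf (f - h) = 0" by (rule nf_I)
  then show "nf f = nf h" by (simp add: nf_diff)
qed

lemma in_I_iff: "f \<in> I \<longleftrightarrow> nf f = 0"
  using nf_eq_iff[of f 0] by (simp add: nf_0)

lemma nf_nf: "nf (nf f) = nf f"
  using nf_eq_iff[of "nf f" f] closed_ideal_uminus[OF closed_I minus_nf_in_I[of f]] by simp

lemma nf_mult_right: "nf (f * nf h) = nf (f * h)"
  using closed_ideal_left[OF closed_I minus_nf_in_I[of h], of f] nf_eq_iff[of "f * h" "f * nf h"]
  by (simp add: right_diff_distrib)

lemma nf_mult_left: "nf (nf f * h) = nf (f * h)"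
  using closed_ideal_right[OF closed_I minus_nf_in_I[of f], of h] nf_eq_iff[of "f * h" "nf f * h"]
  by (simp add: left_diff_distrib)

lemma mon_in_I_iff: "mon w \<in> I \<longleftrightarrow> word_sign w = 0"
proof -
  have "mon (sort w) \<noteq> 0" by (metis keys_mon keys_zero insert_not_empty)
  then show ?thesis by (simp add: in_I_iff nf_mon scal_mult_eq_0)
qed

lemma keys_nf: 
  assumes "v \<in> keys (nf f)"
  shows "std v \<and> (\<exists>w\<in>keys f. sort w = v)"
proof -
  have "(\<Sum>w\<in>keys f. lookup f w * lookup (scal (word_sign w) * mon (sort w)) v) \<noteq> 0"
    using assms unfolding in_keys_iff nf_def lookup_lin_ext by simp
  then obtain w where "w \<in> keys f" "lookup f w * lookup (scal (word_sign w) * mon (sort w)) v \<noteq> 0"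
    by (rule sum.not_neutral_contains_not_neutral)
  then obtain w where "w \<in> keys f" "word_sign w \<noteq> 0" "sort w = v"
    by (auto simp: lookup_scal_mon split: if_splits)
  then show ?thesis using std_sort by blast
qed

text \<open>The range of summation does not depend on \<open>f\<close>. Coefficients of normal forms therefore inherit
  polynomiality and differentiability from the coefficients of \<open>f\<close>.\<close>

lemma lookup_nf:
  "lookup (nf f) v = (\<Sum>w\<in>words (length v). lookup f w * (if sort w = v then word_sign w else 0))"
proof -
  let ?F = "\<lambda>w. lookup f w * (if sort w = v then word_sign w else 0)"
  have "lookup (nf f) v = sum ?F (keys f)"
    unfolding nf_def lookup_lin_ext lookup_scal_mon by (rule refl)
  also have "\<dots> = sum ?F (keys f \<inter> words (length v))"
    by (rule sum.mono_neutral_right) (auto simp: words_def)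
  also have "\<dots> = sum ?F (words (length v))"
    by (rule sum.mono_neutral_left) (auto simp: finite_words in_keys_iff)
  finally show ?thesis .
qed

lemma matrix_polynomial_nf_act: "matrix_polynomial (\<lambda>g. lookup (nf (act g f)) v)"
  unfolding lookup_nf
  by (intro matrix_polynomial_sum matrix_polynomial.mult matrix_polynomial_act matrix_polynomial.const)

text \<open>The relation between two variables holds in the quotient for every pair of indices, in both orders,
  and it is bilinear, so it persists under linear substitutions.\<close>

lemma act_I:
  assumes "f \<in> I"
  shows "act g f \<in> I"
proof -
  have X_comm: "X k * X l - scal q * (X l * X k) \<in> I" for k l
  proof -
    consider "k < l" | "l < k" | "k = l" "q = 1" | "k = l" "q = - 1" using q by fastforce
    then show ?thesis
    proof cases
      case 1
      then show ?thesis by (rule rel_in_I)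
    next
      case 2
      then have "\<not> k < l" by auto
      moreover have "pair_sign k l = q" unfolding pair_sign_def using 2 by auto
      ultimately show ?thesis using mon_pair_in_I[of k l "[]"] by (simp add: mon_Cons mon_Nil)
    next
      case 3
      then show ?thesis using closed_ideal_0[OF closed_I] by (simp add: scal_1)
    next
      case 4
      then show ?thesis
        using closed_ideal_add[OF closed_I square_in_I square_in_I] by (simp add: scal_minus_1)
    qed
  qed
  have gen: "act g (X i * X j - scal q * (X j * X i)) \<in> I" for i j
  proof -
    have "act g (X i * X j) = (\<Sum>k\<in>UNIV. \<Sum>l\<in>UNIV. scal (g $ k $ i * g $ l $ j) * (X k * X l))"
      for i j
    proof -
      have "scal c * X k * (scal d * X l) = scal (c * d) * (X k * X l)" for c d and k l :: 'n
        by (simp only: scal_mult mult.assoc scal_left_commute[of "X k"])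
      then show ?thesis by (simp only: act_mult act_X gen_image_def sum_product)
    qed
    moreover have "act g (X j * X i) =
        (\<Sum>k\<in>UNIV. \<Sum>l\<in>UNIV. scal (g $ k $ i * g $ l $ j) * (X l * X k))"
      unfolding calculation by (subst sum.swap) (simp add: mult.commute[of "_ $ j"])
    ultimately have "act g (X i * X j - scal q * (X j * X i)) =
        (\<Sum>k\<in>UNIV. \<Sum>l\<in>UNIV. scal (g $ k $ i * g $ l $ j) * (X k * X l - scal q * (X l * X k)))"
      by (simp only: act_diff act_scal sum_distrib_left sum_subtractf[symmetric] right_diff_distrib
          scal_left_commute[of "scal q"])
    then show ?thesis by (auto intro!: closed_ideal_sum closed_I closed_ideal_left X_comm)
  qed
  have "I \<subseteq> {f. act g f \<in> I}"
  proof (rule I_least)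
    show "closed_ideal {f. act g f \<in> I}"
      using closed_I by (auto simp: closed_ideal_def act_add act_mult act_0)
    show "X i * X i \<in> {f. act g f \<in> I}" if "q = - 1" for i
    proof -
      have "X i * X i - scal q * (X i * X i) = scal 2 * (X i * X i)"
        using that by (simp add: scal_minus_1 flip: mult_2) (metis scal_add scal_1 one_add_one)
      with gen[of i i] have "scal 2 * act g (X i * X i) \<in> I" by (simp add: act_scal)
      then show ?thesis using closed_ideal_cancel_scal[OF closed_I, of 2] by simp
    qed
  qed (use gen in simp)
  with assms show ?thesis by blast
qed

lemma nf_act_nf: "nf (act g (nf f)) = nf (act g f)"
  using act_I[OF minus_nf_in_I[of f], of g] nf_eq_iff[of "act g f" "act g (nf f)"]
  by (simp add: act_diff)

end

section \<open>Homogeneous components\<close>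

lemma lookup_hom_component: "lookup (hom_component d f) w = (if length w = d then lookup f w else 0)"
proof -
  have "lookup (hom_component d f) w =
      (\<Sum>v\<in>{v \<in> keys f. length v = d}. if v = w then lookup f w else 0)"
    unfolding hom_component_def lookup_sum
    by (rule sum.cong) (auto simp: lookup_single when_def)
  then show ?thesis by (auto simp: in_keys_iff)
qed

lemma keys_hom_component: "keys (hom_component d f) \<subseteq> words d"
  by (auto simp: in_keys_iff lookup_hom_component words_def split: if_splits)

lemma lookup_act_hom_component:
  "lookup (act g (hom_component d f)) w = (if length w = d then lookup (act g f) w else 0)"
proof (induction f rule: free_alg_induct)
  case (mon c v)
  have "hom_component d (scal c * mon v) = (if length v = d then scal c * mon v else 0)"
    by (rule poly_mapping_eqI) (auto simp: lookup_hom_component lookup_scal_mon)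
  then show ?case by (auto simp: act_scal lookup_scal_mult lookup_act_mon_length act_0)
next
  case (add f h)
  have "hom_component d (f + h) = hom_component d f + hom_component d h"
    by (rule poly_mapping_eqI) (simp add: lookup_hom_component lookup_add)
  with add show ?case by (auto simp: act_add lookup_add)
qed

lemma (in quadratic_quotient) lookup_nf_act_hom_component:
  "lookup (nf (act g (hom_component d f))) v = (if length v = d then lookup (nf (act g f)) v else 0)"
  by (auto simp: lookup_nf lookup_act_hom_component words_def intro!: sum.cong sum.neutral)

lemma keys_act: "keys f \<subseteq> words d \<Longrightarrow> keys (act g f) \<subseteq> words d"
proof
  fix w assume f: "keys f \<subseteq> words d" and w: "w \<in> keys (act g f)"
  have "(\<Sum>v\<in>keys f. lookup f v * lookup (act g (mon v)) w) \<noteq> 0"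
    using w unfolding in_keys_iff by (subst (asm) lookup_act)
  then obtain v where "v \<in> keys f" "lookup f v * lookup (act g (mon v)) w \<noteq> 0"
    by (rule sum.not_neutral_contains_not_neutral)
  with f show "w \<in> words d" using lookup_act_mon_length[of v w g] by (force simp: words_def)
qed

lemma (in quadratic_quotient) keys_nf_words: "keys f \<subseteq> words d \<Longrightarrow> keys (nf f) \<subseteq> words d"
  using keys_nf[of _ f] by (fastforce simp: words_def)

section \<open>The quotient algebra\<close>

context quadratic_quotient
begin

lemma ideal_I: "ideal I T"
  by (simp add: ideal_T_iff closed_I)

lemma mem_proj_iff: "x \<in> proj I f \<longleftrightarrow> nf x = nf f"
proof -
  have "proj I f = {i + f | i. i \<in> I}"
    by (auto simp: proj_def a_r_coset_def r_coset_def T_def)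
  moreover have "x = (x - f) + f" by simp
  ultimately show ?thesis by (auto simp: nf_eq_iff)
qed

lemma proj_eq_iff: "proj I f = proj I h \<longleftrightarrow> nf f = nf h"
  by (auto simp: mem_proj_iff set_eq_iff)

text \<open>The standard monomials span the quotient, so a linear section is determined by its values on
  them.\<close>

lemma std_section_unique:
  assumes "std_section I std d"
  shows "d (proj I f) = nf f"
proof -
  have d_add: "d (proj I (f + g)) = d (proj I f) + d (proj I g)" for f g
    using assms by (simp add: std_section_def)
  have d_scal: "d (proj I (scal c * f)) = scal c * d (proj I f)" for c f
    using assms by (simp add: std_section_def)
  have d_std: "d (proj I (mon w)) = mon w" if "std w" for w
    using assms that by (simp add: std_section_def)
  have lin: "d (proj I h) = lin_ext (\<lambda>w. d (proj I (mon w))) h" for h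
  proof (induction h rule: free_alg_induct)
    case (mon c w)
    show ?case by (simp only: d_scal lin_ext_scal lin_ext_mon)
  next
    case (add f g)
    then show ?case by (simp only: d_add lin_ext_add)
  qed
  have "proj I f = proj I (nf f)" by (simp add: proj_eq_iff nf_nf)
  then have "d (proj I f) = d (proj I (nf f))" by simp
  also have "\<dots> = lin_ext (\<lambda>w. d (proj I (mon w))) (nf f)" by (rule lin)
  also have "\<dots> = lin_ext mon (nf f)"
    unfolding lin_ext_def by (rule sum.cong) (auto simp: d_std dest: keys_nf)
  finally show ?thesis by (simp add: lin_ext_mon_id)
qed

lemma delta_proj: "delta I std (proj I f) = nf f"
proof -
  define d where "d y = nf (SOME f. f \<in> y)" for y
  have d: "d (proj I f) = nf f" for f
  proof -
    have "(SOME h. h \<in> proj I f) \<in> proj I f" by (rule someI[of _ f]) (simp add: mem_proj_iff)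
    then show ?thesis by (simp add: d_def mem_proj_iff)
  qed
  have "std_section I std d"
    by (auto simp: std_section_def d nf_add nf_scal nf_mon_std proj_eq_iff nf_nf)
  then have "std_section I std (delta I std)"
    unfolding delta_def by (rule someI[of "std_section I std"])
  then show ?thesis by (rule std_section_unique)
qed

lemma delta_proj_mon: "std w \<Longrightarrow> delta I std (proj I (mon w)) = mon w"
  by (simp add: delta_proj nf_mon_std)

lemma nf_act_cong: "nf f = nf h \<Longrightarrow> nf (act g f) = nf (act g h)"
  by (metis nf_act_nf)

lemma quot_act_proj:
  assumes "g \<in> GL"
  shows "quot_act g (proj I f) = proj I (act g f)"
proof -
  obtain h where h: "g ** h = mat 1" "h ** g = mat 1" using assms by (rule GL_inverse)
  show ?thesis
  proof (rule Set.set_eqI)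
    fix x
    have "x \<in> quot_act g (proj I f) \<longleftrightarrow> (\<exists>y. nf y = nf f \<and> x = act g y)"
      by (auto simp: quot_act_def mem_proj_iff)
    also have "\<dots> \<longleftrightarrow> nf x = nf (act g f)"
    proof
      assume "nf x = nf (act g f)"
      then have "nf (act h x) = nf (act h (act g f))" by (rule nf_act_cong)
      then have "nf (act h x) = nf f \<and> x = act g (act h x)"
        by (simp add: act_comp h act_mat_1)
      then show "\<exists>y. nf y = nf f \<and> x = act g y" by blast
    qed (auto intro: nf_act_cong)
    finally show "x \<in> quot_act g (proj I f) \<longleftrightarrow> x \<in> proj I (act g f)" by (simp add: mem_proj_iff)
  qed
qed

text \<open>Ideals of the quotient are the images of the ideals of the free algebra containing \<open>I\<close>.\<close>

lemma Idl_quot: "Idl\<^bsub>T Quot I\<^esub> (proj I ` S) = proj I ` (Idl\<^bsub>T\<^esub> (S \<union> I))"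
proof
  interpret I: ideal I "T :: 'n free_alg ring" by (rule ideal_I)
  interpret Q: ring "T Quot I" by (rule I.quotient_is_ring)
  interpret h: ring_hom_ring T "T Quot I" "proj I"
    using I.rcos_ring_hom_ring by (simp add: proj_def[abs_def])
  have carrier: "proj I ` S \<subseteq> carrier (T Quot I)" using h.hom_closed by auto
  show "Idl\<^bsub>T Quot I\<^esub> (proj I ` S) \<subseteq> proj I ` (Idl\<^bsub>T\<^esub> (S \<union> I))"
  proof (rule Q.genideal_minimal)
    have "ideal ((+>\<^bsub>T\<^esub>) I ` (Idl\<^bsub>T\<^esub> (S \<union> I))) (T Quot I)"
      by (rule ring.ring_ideal_imp_quot_ideal[OF ring_T ideal_I])
        (simp add: ideal_T_iff closed_ideal_Idl)
    then show "ideal (proj I ` (Idl\<^bsub>T\<^esub> (S \<union> I))) (T Quot I)" by (simp add: proj_def[abs_def])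
    show "proj I ` S \<subseteq> proj I ` (Idl\<^bsub>T\<^esub> (S \<union> I))"
      using Idl_superset[of "S \<union> I"] by blast
  qed
  let ?K = "{r \<in> carrier T. proj I r \<in> Idl\<^bsub>T Quot I\<^esub> (proj I ` S)}"
  have id: "ideal (Idl\<^bsub>T Quot I\<^esub> (proj I ` S)) (T Quot I)"
    using h.hom_closed by (intro Q.genideal_ideal) auto
  have "ideal ?K T" using h.ideal_vimage[OF id] .
  moreover have "S \<subseteq> ?K" using Q.genideal_self[OF carrier] by auto
  moreover have "I \<subseteq> ?K"
  proof
    fix f assume "f \<in> I"
    then have "proj I f = proj I 0" by (simp add: proj_eq_iff nf_I nf_0)
    also have "\<dots> = \<zero>\<^bsub>T Quot I\<^esub>" using h.hom_zero by simp
    also have "\<dots> \<in> Idl\<^bsub>T Quot I\<^esub> (proj I ` S)"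
      using id by (simp add: ideal_def additive_subgroup.zero_closed)
    finally show "f \<in> ?K" by simp
  qed
  ultimately have "Idl\<^bsub>T\<^esub> (S \<union> I) \<subseteq> ?K" by (intro Idl_least) (auto simp: ideal_T_iff)
  then show "proj I ` (Idl\<^bsub>T\<^esub> (S \<union> I)) \<subseteq> Idl\<^bsub>T Quot I\<^esub> (proj I ` S)" by auto
qed

text \<open>The preimage in the free algebra of the monomial ideal of the quotient generated by the images of
  \<open>S\<close>: monomials of the quotient divide each other if and only if their multisets are included in
  each other (lemma \<open>Idl_mon_I\<close>).\<close>

definition multiples :: "'n list set \<Rightarrow> 'n free_alg set" where
  "multiples S = {f. \<forall>v\<in>keys (nf f). \<exists>s\<in>S. mset s \<subseteq># mset v}"

lemma mon_in_multiples_iff: "std w \<Longrightarrow> mon w \<in> multiples S \<longleftrightarrow> (\<exists>s\<in>S. mset s \<subseteq># mset w)"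
  by (simp add: multiples_def nf_mon_std keys_mon)

lemma closed_ideal_multiples: "closed_ideal (multiples S)"
proof (rule closed_idealI_mon, goal_cases)
  case (2 f g)
  then show ?case using keys_add[of "nf f" "nf g"] by (fastforce simp: multiples_def nf_add)
next
  case (3 c f)
  then show ?case by (auto simp: multiples_def nf_scal in_keys_iff lookup_scal_mult)
next
  case (4 w f)
  show ?case unfolding multiples_def
  proof (intro CollectI ballI)
    fix v assume "v \<in> keys (nf (mon w * f))"
    then have "v \<in> keys (nf (mon w * nf f))" by (simp add: nf_mult_right)
    then obtain x where "x \<in> keys (mon w * nf f)" "sort x = v" using keys_nf by blast
    moreover from this(1) obtain y where "y \<in> keys (nf f)" "x = w @ y"
      using keys_mult[of "mon w" "nf f"] by (auto simp: keys_mon plus_list_def)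
    moreover from this(1) 4 obtain s where "s \<in> S" "mset s \<subseteq># mset y" by (auto simp: multiples_def)
    ultimately show "\<exists>s\<in>S. mset s \<subseteq># mset v"
      by (intro bexI[of _ s]) (auto intro: subset_mset.order_trans)
  qed
next
  case (5 w f)
  show ?case unfolding multiples_def
  proof (intro CollectI ballI)
    fix v assume "v \<in> keys (nf (f * mon w))"
    then have "v \<in> keys (nf (nf f * mon w))" by (simp add: nf_mult_left)
    then obtain x where "x \<in> keys (nf f * mon w)" "sort x = v" using keys_nf by blast
    moreover from this(1) obtain y where "y \<in> keys (nf f)" "x = y @ w"
      using keys_mult[of "nf f" "mon w"] by (auto simp: keys_mon plus_list_def)
    moreover from this(1) 5 obtain s where "s \<in> S" "mset s \<subseteq># mset y" by (auto simp: multiples_def)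
    ultimately show "\<exists>s\<in>S. mset s \<subseteq># mset v"
      by (intro bexI[of _ s]) (auto intro: subset_mset.order_trans)
  qed
qed (simp add: multiples_def nf_0)

lemma I_subset_multiples: "I \<subseteq> multiples S"
  by (auto simp: multiples_def nf_I)

lemma Idl_mon_I:
  assumes "\<And>s. s \<in> S \<Longrightarrow> std s"
  shows "Idl\<^bsub>T\<^esub> (mon ` S \<union> I) = multiples S"
proof
  show "Idl\<^bsub>T\<^esub> (mon ` S \<union> I) \<subseteq> multiples S"
    using I_subset_multiples assms
    by (intro Idl_least closed_ideal_multiples) (auto simp: mon_in_multiples_iff)
  let ?J = "Idl\<^bsub>T\<^esub> (mon ` S \<union> I)"
  have S: "mon s \<in> ?J" if "s \<in> S" for s
    using Idl_superset[of "mon ` S \<union> I"] that by blast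
  have IJ: "I \<subseteq> ?J" using Idl_superset[of "mon ` S \<union> I"] by blast
  show "multiples S \<subseteq> ?J"
  proof
    fix f assume f: "f \<in> multiples S"
    have "mon v \<in> ?J" if "v \<in> keys (nf f)" for v
    proof -
      from f that obtain s where s: "s \<in> S" "mset s \<subseteq># mset v" by (auto simp: multiples_def)
      obtain u where u: "mset u = mset v - mset s" using ex_mset by blast
      have v: "std v" using keys_nf that by blast
      have uv: "mset (u @ s) = mset v" using u s(2) by simp
      then have "nf (mon (u @ s)) = scal (word_sign (u @ s)) * mon v"
        using v by (metis nf_mon sort_eq_iff sort_std)
      moreover have "word_sign (u @ s) \<noteq> 0"
        using word_sign_mset[OF uv] v by (simp add: std_def)
      moreover have "mon (u @ s) \<in> ?J"
        unfolding mon_append by (intro closed_ideal_left closed_ideal_Idl S s)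
      moreover have "mon (u @ s) - nf (mon (u @ s)) \<in> ?J" using minus_nf_in_I IJ by blast
      ultimately show ?thesis
        using closed_ideal_diff[OF closed_ideal_Idl, of "mon (u @ s)" "mon ` S \<union> I"]
          closed_ideal_cancel_scal[OF closed_ideal_Idl, of "word_sign (u @ s)" "mon v"]
        by fastforce
    qed
    then have "lin_ext mon (nf f) \<in> ?J" unfolding lin_ext_def
      by (intro closed_ideal_sum closed_ideal_Idl closed_ideal_left)
    then have "nf f + (f - nf f) \<in> ?J"
      using minus_nf_in_I IJ by (intro closed_ideal_add closed_ideal_Idl) (auto simp: lin_ext_mon_id)
    then show "f \<in> ?J" by simp
  qed
qed

lemma Idl_quot_mon:
  "(\<And>s. s \<in> S \<Longrightarrow> std s) \<Longrightarrow> Idl\<^bsub>T Quot I\<^esub> (proj I ` mon ` S) = proj I ` multiples S"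
  by (simp add: Idl_quot Idl_mon_I)

lemma proj_mon_in_iff:
  assumes "std w"
  shows "proj I (mon w) \<in> proj I ` multiples S \<longleftrightarrow> (\<exists>s\<in>S. mset s \<subseteq># mset w)"
proof
  assume "proj I (mon w) \<in> proj I ` multiples S"
  then obtain f where "f \<in> multiples S" "nf (mon w) = nf f" by (auto simp: proj_eq_iff)
  then have "mon w \<in> multiples S" by (simp add: multiples_def)
  then show "\<exists>s\<in>S. mset s \<subseteq># mset w" by (simp add: mon_in_multiples_iff assms)
qed (simp add: mon_in_multiples_iff[OF assms, symmetric])

definition minimal_words :: "'n list set \<Rightarrow> 'n list set" where
  "minimal_words G = {w \<in> G. \<forall>v\<in>G. mset v \<subseteq># mset w \<longrightarrow> v = w}"

lemma minimal_words_below: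
  assumes G: "\<And>w. w \<in> G \<Longrightarrow> std w" and "w \<in> G"
  shows "\<exists>m\<in>minimal_words G. mset m \<subseteq># mset w"
  using assms(2)
proof (induction w rule: measure_induct_rule[of length])
  case (less w)
  show ?case
  proof (cases "w \<in> minimal_words G")
    case False
    with less.prems obtain v where v: "v \<in> G" "mset v \<subseteq># mset w" "v \<noteq> w"
      by (auto simp: minimal_words_def)
    then have "mset v \<noteq> mset w" using std_mset_inj G less.prems by blast
    with v have "size (mset v) < size (mset w)" by (intro mset_subset_size) (simp add: subset_mset_def)
    with less.IH[of v] v obtain m where "m \<in> minimal_words G" "mset m \<subseteq># mset v" by auto
    with v(2) show ?thesis using subset_mset.order_trans by blast
  qed auto
qed

lemma multiples_minimal_words:
  assumes "\<And>w. w \<in> G \<Longrightarrow> std w"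
  shows "multiples (minimal_words G) = multiples G"
proof
  show "multiples (minimal_words G) \<subseteq> multiples G"
    by (auto simp: multiples_def minimal_words_def)
  show "multiples G \<subseteq> multiples (minimal_words G)"
    unfolding multiples_def using minimal_words_below[OF assms]
    by (clarsimp) (meson subset_mset.order_trans)
qed

text \<open>A set of monomials generating the ideal contains a divisor of every divisibility-minimal monomial,
  that is, the monomial itself. So the minimal monomials are contained in every generating set, and
  they generate.\<close>

lemma min_gens_quot:
  assumes G: "\<And>w. w \<in> G \<Longrightarrow> std w"
  shows "min_gens (T Quot I) (quot_monomials I std) (proj I ` multiples G) = proj I ` mon ` minimal_words G"
  unfolding min_gens_def
proof (rule the_equality)
  have Gm: "std w" if "w \<in> minimal_words G" for w using that G by (simp add: minimal_words_def)
  have gen: "Idl\<^bsub>T Quot I\<^esub> (proj I ` mon ` minimal_words G) = proj I ` multiples G"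
    using Gm by (simp add: Idl_quot_mon multiples_minimal_words G)
  have sub: "minimal_words G \<subseteq> S"
    if S: "\<And>s. s \<in> S \<Longrightarrow> std s" and SG: "Idl\<^bsub>T Quot I\<^esub> (proj I ` mon ` S) = proj I ` multiples G" for S
  proof
    have eq: "proj I ` multiples S = proj I ` multiples G" using S SG by (simp add: Idl_quot_mon)
    fix w assume w: "w \<in> minimal_words G"
    then have "proj I (mon w) \<in> proj I ` multiples G"
      using proj_mon_in_iff[OF Gm[OF w], of G] by (auto simp: minimal_words_def)
    then obtain s where s: "s \<in> S" "mset s \<subseteq># mset w"
      using proj_mon_in_iff[OF Gm[OF w], of S] eq by auto
    then have "proj I (mon s) \<in> proj I ` multiples G"
      using proj_mon_in_iff[OF S[OF s(1)], of S] eq by auto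
    then obtain v where v: "v \<in> G" "mset v \<subseteq># mset s"
      using proj_mon_in_iff[OF S[OF s(1)], of G] by auto
    then have "v = w" using w s(2) subset_mset.order_trans by (fastforce simp: minimal_words_def)
    with v s have "mset s = mset w" by (simp add: subset_mset.order_antisym)
    then have "s = w" using std_mset_inj S s(1) Gm w by blast
    with s show "w \<in> S" by simp
  qed
  show "proj I ` mon ` minimal_words G \<subseteq> quot_monomials I std \<and>
      minimally_generates (T Quot I) (proj I ` mon ` minimal_words G) (proj I ` multiples G)"
    unfolding minimally_generates_def
  proof (intro conjI allI impI gen)
    show "proj I ` mon ` minimal_words G \<subseteq> quot_monomials I std"
      using Gm by (auto simp: quot_monomials_def)
    fix C assume C: "C \<subset> proj I ` mon ` minimal_words G"
    then have "C \<subseteq> (\<lambda>w. proj I (mon w)) ` minimal_words G" by (auto simp: image_image)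
    then obtain S where S: "S \<subseteq> minimal_words G" "C = (\<lambda>w. proj I (mon w)) ` S"
      by (auto simp: subset_image_iff)
    then have CS: "C = proj I ` mon ` S" by (simp add: image_image)
    show "Idl\<^bsub>T Quot I\<^esub> C \<noteq> proj I ` multiples G"
    proof
      assume eq: "Idl\<^bsub>T Quot I\<^esub> C = proj I ` multiples G"
      have "minimal_words G \<subseteq> S"
      proof (rule sub)
        show "std s" if "s \<in> S" for s using that S(1) Gm by blast
      qed (use eq CS in simp)
      then have "proj I ` mon ` minimal_words G \<subseteq> C" unfolding CS by (intro image_mono)
      then have "\<not> C \<subset> proj I ` mon ` minimal_words G" by (rule leD)
      with C show False by contradiction
    qed
  qed
  fix B assume B: "B \<subseteq> quot_monomials I std \<and> minimally_generates (T Quot I) B (proj I ` multiples G)"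
  define S where "S = {w. std w \<and> proj I (mon w) \<in> B}"
  have BS: "B = proj I ` mon ` S" using B by (auto simp: S_def quot_monomials_def)
  have "minimal_words G \<subseteq> S"
  proof (rule sub)
    show "std s" if "s \<in> S" for s using that by (simp add: S_def)
    show "Idl\<^bsub>T Quot I\<^esub> (proj I ` mon ` S) = proj I ` multiples G"
      using B unfolding minimally_generates_def BS by (rule conjunct2[THEN conjunct1])
  qed
  then have "proj I ` mon ` minimal_words G \<subseteq> B" unfolding BS by blast
  moreover have "\<not> proj I ` mon ` minimal_words G \<subset> B"
  proof
    have m: "\<forall>C. C \<subset> B \<longrightarrow> Idl\<^bsub>T Quot I\<^esub> C \<noteq> proj I ` multiples G"
      using B unfolding minimally_generates_def by (elim conjE)
    assume "proj I ` mon ` minimal_words G \<subset> B"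
    from m[rule_format, OF this] gen show False by (rule notE)
  qed
  ultimately show "B = proj I ` mon ` minimal_words G" by blast
qed

end

section \<open>Initial words\<close>

locale ordered_quotient = quadratic_quotient q I for q and I :: "'n::{finite,linorder} free_alg set" +
  fixes lt :: "'n multiset \<Rightarrow> 'n multiset \<Rightarrow> bool"
  assumes monoid_well_order: "monoid_well_order lt"
begin

lemma lt_trans: "lt x y \<Longrightarrow> lt y z \<Longrightarrow> lt x z"
  using monoid_well_order by (auto simp: monoid_well_order_def dest: transpD)

lemma lt_linear: "x \<noteq> y \<Longrightarrow> lt x y \<or> lt y x"
  using monoid_well_order by (auto simp: monoid_well_order_def dest: totalpD)

lemma lt_wf: "wfp lt"
  using monoid_well_order by (simp add: monoid_well_order_def)

lemma lt_irrefl: "\<not> lt x x"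
  using lt_wf by (metis irreflpD wfp_imp_irreflp)

lemma lt_asym: "lt x y \<Longrightarrow> \<not> lt y x"
  using lt_trans lt_irrefl by blast

lemma lt_add: "lt x y \<Longrightarrow> lt (k + x) (k + y)"
  using monoid_well_order by (simp add: monoid_well_order_def)

lemma lt_add_cancel: "lt (k + x) (k + y) \<Longrightarrow> lt x y"
  using lt_linear lt_add lt_asym lt_irrefl by metis

abbreviation word_lt :: "'n list \<Rightarrow> 'n list \<Rightarrow> bool" where
  "word_lt v w \<equiv> lt (mset v) (mset w)"

text \<open>The standard words of the initial monomials of the image of $g(a)$ in the quotient.\<close>

definition initial_words :: "'n free_alg set \<Rightarrow> ((complex, 'n) vec, 'n) vec \<Rightarrow> 'n list set" where
  "initial_words a g = {w. \<exists>f\<in>a. initial_word word_lt (nf (act g f)) w}"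

lemma initial_words_std: "w \<in> initial_words a g \<Longrightarrow> std w"
  using keys_nf by (auto simp: initial_words_def initial_word_def)

lemma init_Q_eq:
  assumes "g \<in> GL"
  shows "init_Q I std lt (quot_act g ` proj I ` a) = proj I ` multiples (initial_words a g)"
proof -
  have "{proj I (mon w) | y w. y \<in> quot_act g ` proj I ` a \<and> initial_word word_lt (delta I std y) w} =
      proj I ` mon ` initial_words a g"
    (is "?L = ?R")
  proof (intro equalityI subsetI)
    fix x assume "x \<in> ?L"
    then show "x \<in> ?R"
      using assms by (fastforce simp: initial_words_def quot_act_proj delta_proj)
  next
    fix x assume "x \<in> ?R"
    then obtain w f where w: "x = proj I (mon w)" "f \<in> a" "initial_word word_lt (nf (act g f)) w"
      by (auto simp: initial_words_def)
    then have "initial_word word_lt (delta I std (quot_act g (proj I f))) w"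
      using assms by (simp add: quot_act_proj delta_proj)
    with w show "x \<in> ?L" by blast
  qed
  then show ?thesis unfolding init_Q_def by (simp only: Idl_quot_mon[OF initial_words_std])
qed

text \<open>Multiplication by a monomial preserves the order of the monomials that it does not annihilate, and
  it does not annihilate the leading one, since \<open>v\<close> is standard.\<close>

lemma initial_words_mult:
  assumes a: "closed_ideal a" and g: "g \<in> GL" and w: "w \<in> initial_words a g"
    and v: "std v" "mset w \<subseteq># mset v"
  shows "v \<in> initial_words a g"
proof -
  obtain h where h: "g ** h = mat 1" "h ** g = mat 1" using g by (rule GL_inverse)
  from w obtain f where f: "f \<in> a" "initial_word word_lt (nf (act g f)) w"
    by (auto simp: initial_words_def)
  obtain u where u: "mset u = mset v - mset w" using ex_mset by blast
  have uw: "mset v = mset u + mset w" using u v(2) by simp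
  let ?f = "act h (mon u) * f"
  have "nf (act g ?f) = nf (mon u * nf (act g f))"
    by (simp add: act_mult act_comp h act_mat_1 nf_mult_right)
  also have "initial_word word_lt \<dots> v"
    unfolding initial_word_def
  proof (intro conjI ballI impI)
    fix x assume x: "x \<in> keys (nf (mon u * nf (act g f)))" "x \<noteq> v"
    then obtain y where y: "y \<in> keys (mon u * nf (act g f))" "sort y = x" and "std x"
      using keys_nf by blast
    then obtain z where z: "z \<in> keys (nf (act g f))" "y = u @ z"
      using keys_mult[of "mon u" "nf (act g f)"] by (auto simp: keys_mon plus_list_def)
    have x_eq: "mset x = mset u + mset z" using y(2) z(2) by auto
    then have "z \<noteq> w" using x(2) uw std_mset_inj \<open>std x\<close> v(1) by auto
    then have "word_lt z w" using f(2) z(1) by (auto simp: initial_word_def)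
    then show "word_lt x v" by (simp add: x_eq uw lt_add)
  next
    let ?F = "nf (act g f)"
    \<comment> \<open>among the terms of \<open>?F\<close> only the leading one contributes to the coefficient of \<open>v\<close>\<close>
    have eq: "nf (mon u * ?F) = (\<Sum>z\<in>keys ?F. scal (lookup ?F z) * nf (mon (u @ z)))"
    proof -
      have "mon u * ?F = mon u * lin_ext mon ?F" by (simp only: lin_ext_mon_id)
      also have "\<dots> = (\<Sum>z\<in>keys ?F. scal (lookup ?F z) * mon (u @ z))"
        unfolding lin_ext_def sum_distrib_left mon_append
        by (rule sum.cong[OF refl]) (rule scal_left_commute)
      finally show ?thesis by (simp add: nf_sum nf_scal)
    qed
    have "lookup (nf (mon (u @ z))) v = (if z = w then word_sign (u @ w) else 0)"
      if z: "z \<in> keys ?F" for z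
    proof -
      have "sort (u @ z) = v \<longleftrightarrow> z = w"
      proof
        assume "sort (u @ z) = v"
        then have "mset z = mset w" using uw by (metis add_left_cancel mset_append mset_sort)
        moreover have "std z" "std w" using keys_nf z f(2) by (auto simp: initial_word_def)
        ultimately show "z = w" by (simp add: std_mset_inj)
      next
        assume "z = w"
        then show "sort (u @ z) = v" using uw v(1) by (metis mset_append sort_eq_iff sort_std)
      qed
      then show ?thesis by (auto simp: nf_mon lookup_scal_mon)
    qed
    then have "lookup (nf (mon u * ?F)) v =
        (\<Sum>z\<in>keys ?F. if z = w then lookup ?F w * word_sign (u @ w) else 0)"
      unfolding eq lookup_sum lookup_scal_mult by (intro sum.cong) auto
    moreover have "w \<in> keys ?F" using f(2) by (simp add: initial_word_def)
    moreover have "word_sign (u @ w) \<noteq> 0"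
      using word_sign_mset[of "u @ w" v] uw v(1) by (simp add: std_def)
    ultimately show "v \<in> keys (nf (mon u * ?F))" by (simp add: in_keys_iff)
  qed
  finally have "initial_word word_lt (nf (act g ?f)) v" .
  moreover have "?f \<in> a" using closed_ideal_left[OF a f(1)] .
  ultimately show ?thesis by (auto simp: initial_words_def)
qed

text \<open>The words that are not standard are initial words of relations. The conditions on \<open>ord\<close> say that
  a standard word is smaller than every other word with the same non-zero commutative image and
  that standard words are compared by their images. Under these conditions an initial word that is
  standard remains the largest word in the normal form: the other words with non-zero image are
  sent to smaller standard words, and the words with image zero disappear.\<close>

lemma init_T_eq:
  assumes Ia: "I \<subseteq> a" and a: "closed_ideal a" and g: "g \<in> GL"
    and ord_lt: "\<And>v w. std w \<Longrightarrow> v \<noteq> w \<Longrightarrow> word_sign v \<noteq> 0 \<Longrightarrow> ord v w \<Longrightarrow> word_lt v w"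
    and lt_ord: "\<And>v w. std v \<Longrightarrow> std w \<Longrightarrow> word_lt v w \<Longrightarrow> ord v w"
    and ord_sort: "\<And>w. word_sign w \<noteq> 0 \<Longrightarrow> \<not> sorted w \<Longrightarrow> ord (sort w) w"
  shows "init_T ord (act g ` a) = Idl\<^bsub>T\<^esub> (mon ` (initial_words a g \<union> {w. \<not> std w}))"
proof -
  obtain h where h: "g ** h = mat 1" "h ** g = mat 1" using g by (rule GL_inverse)
  have I: "f \<in> act g ` a" if "f \<in> I" for f
  proof -
    have "act h f \<in> a" using act_I[OF that] Ia by blast
    moreover have "f = act g (act h f)" by (simp add: act_comp h act_mat_1)
    ultimately show ?thesis by blast
  qed
  have "{w. \<exists>f \<in> act g ` a. initial_word ord f w} = initial_words a g \<union> {w. \<not> std w}"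
  proof (intro equalityI subsetI)
    fix w assume "w \<in> {w. \<exists>f \<in> act g ` a. initial_word ord f w}"
    then obtain f where f: "f \<in> a" "initial_word ord (act g f) w" by blast
    show "w \<in> initial_words a g \<union> {w. \<not> std w}"
    proof (cases "std w")
      case True
      let ?F = "act g f"
      have *: "word_lt v w" if "v \<in> keys ?F" "word_sign v \<noteq> 0" "v \<noteq> w" for v
        using f(2) ord_lt[OF True that(3,2)] that by (auto simp: initial_word_def)
      have "lookup (nf ?F) w = (\<Sum>v\<in>words (length w). if v = w then lookup ?F w else 0)"
        unfolding lookup_nf
      proof (rule sum.cong[OF refl])
        fix v
        show "lookup ?F v * (if sort v = w then word_sign v else 0) = (if v = w then lookup ?F w else 0)"
        proof (cases "v = w")
          case False
          have "\<not> word_lt v w" if "sort v = w" using that lt_irrefl[of "mset w"] by auto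
          then show ?thesis using *[of v] False by (auto simp: in_keys_iff)
        qed (use True in \<open>simp add: word_sign_std sort_std\<close>)
      qed
      then have "lookup (nf ?F) w = lookup ?F w"
        by (simp add: finite_words) (simp add: words_def)
      moreover have "word_lt v w" if v: "v \<in> keys (nf ?F)" "v \<noteq> w" for v
      proof -
        obtain x where x: "x \<in> keys ?F" "sort x = v" "std v" using keys_nf v(1) by blast
        have "word_sign x \<noteq> 0" using word_sign_mset[of x v] x by (auto simp: std_def)
        moreover have "x \<noteq> w" using x(2) v(2) True sort_std by blast
        ultimately have "word_lt x w" using * x(1) by blast
        then show ?thesis using x(2) by auto
      qed
      ultimately have "initial_word word_lt (nf ?F) w"
        using f(2) by (simp add: initial_word_def in_keys_iff)
      with f(1) show ?thesis by (auto simp: initial_words_def)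
    qed simp
  next
    fix w assume "w \<in> initial_words a g \<union> {w. \<not> std w}"
    then consider "w \<in> initial_words a g" | "word_sign w = 0" | "\<not> sorted w" "word_sign w \<noteq> 0"
      by (auto simp: std_def)
    then show "w \<in> {w. \<exists>f \<in> act g ` a. initial_word ord f w}"
    proof cases
      case 1
      then obtain f where f: "f \<in> a" "initial_word word_lt (nf (act g f)) w"
        by (auto simp: initial_words_def)
      have "act g f - nf (act g f) \<in> act g ` a" using I minus_nf_in_I by blast
      then obtain f' where f': "f' \<in> a" "act g f - nf (act g f) = act g f'" by blast
      have "nf (act g f) = act g (f - f')" by (simp add: act_diff f'(2)[symmetric])
      moreover have "f - f' \<in> a" using a f(1) f'(1) by (rule closed_ideal_diff)
      moreover have "initial_word ord (nf (act g f)) w"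
        using f(2) lt_ord keys_nf by (auto simp: initial_word_def)
      ultimately show ?thesis by (metis (mono_tags, lifting) image_eqI mem_Collect_eq)
    next
      case 2
      then have "mon w \<in> act g ` a" by (simp add: I mon_in_I_iff)
      moreover have "initial_word ord (mon w) w" by (simp add: initial_word_def keys_mon)
      ultimately show ?thesis by blast
    next
      case 3
      let ?f = "mon w - nf (mon w)"
      have "sort w \<noteq> w" using 3(1) by (metis sorted_sort)
      then have lookup: "lookup ?f v = (if v = w then 1 else if v = sort w then - word_sign w else 0)" for v
        by (auto simp: lookup_minus nf_mon lookup_scal_mon lookup_mon)
      have "initial_word ord ?f w"
        using ord_sort[OF 3(2,1)] by (auto simp: initial_word_def in_keys_iff lookup split: if_splits)
      then show ?thesis using I[OF minus_nf_in_I] by blast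
    qed
  qed
  moreover have "{mon w | f w. f \<in> act g ` a \<and> initial_word ord f w} =
      mon ` {w. \<exists>f \<in> act g ` a. initial_word ord f w}" by blast
  ultimately show ?thesis unfolding init_T_def by simp
qed

end

section \<open>Polynomial families\<close>

text \<open>The module generated by the maps $g \mapsto g(f)$, $f \in W$, over the polynomials in the matrix
  entries.\<close>

inductive_set families :: "'n::finite free_alg set \<Rightarrow> (complex ^ 'n ^ 'n \<Rightarrow> 'n free_alg) set"
  for W where
  base: "matrix_polynomial p \<Longrightarrow> f \<in> W \<Longrightarrow> (\<lambda>g. scal (p g) * act g f) \<in> families W"
| plus: "F \<in> families W \<Longrightarrow> H \<in> families W \<Longrightarrow> (\<lambda>g. F g + H g) \<in> families W"

lemma families_act: "f \<in> W \<Longrightarrow> (\<lambda>g. act g f) \<in> families W"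
  using families.base[OF matrix_polynomial.const[of 1]] by (simp add: scal_1)

lemma families_scale:
  assumes "matrix_polynomial p" "F \<in> families W"
  shows "(\<lambda>g. scal (p g) * F g) \<in> families W"
  using assms(2)
proof (induction rule: families.induct)
  case (base r f)
  have "(\<lambda>g. scal (p g * r g) * act g f) \<in> families W"
    by (intro families.base matrix_polynomial.mult assms(1) base)
  then show ?case by (simp only: scal_mult mult.assoc)
next
  case (plus F H)
  then show ?case using families.plus[OF plus.IH] by (simp add: distrib_left)
qed

lemma families_diff:
  assumes "F \<in> families W" "H \<in> families W"
  shows "(\<lambda>g. F g - H g) \<in> families W"
  using families.plus[OF assms(1) families_scale[OF matrix_polynomial.const[of "- 1"] assms(2)]]
  by (simp add: scal_minus_1)

lemma families_value:
  assumes "free_alg.subspace W" "F \<in> families W"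
  shows "\<exists>f\<in>W. F g = act g f"
  using assms(2)
proof (induction rule: families.induct)
  case (base p f)
  then show ?case
    by (intro bexI[of _ "scal (p g) * f"] free_alg.subspace_scale assms(1)) (auto simp: act_scal)
next
  case (plus F H)
  then obtain f h where "f \<in> W" "F g = act g f" "h \<in> W" "H g = act g h" by blast
  then show ?case
    by (intro bexI[of _ "f + h"] free_alg.subspace_add assms(1)) (auto simp: act_add)
qed

text \<open>Since $u_t (u_t^{-1} g) f = g f$, passing from $F(g)$ to $u_t F(u_t^{-1} g)$ only changes the
  polynomial coefficients of the family. Differentiating these coefficients with respect to \<open>t\<close>
  yields a family again.\<close>

lemma families_derivative:
  fixes F :: "complex ^ 'n ^ 'n \<Rightarrow> 'n::finite free_alg"
  assumes "F \<in> families W" "i \<noteq> j"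
  shows "\<exists>F'\<in>families W. \<forall>g w. ((\<lambda>t. lookup (act (transvection i j t) (F (transvection i j (- t) ** g))) w)
    has_field_derivative lookup (F' g) w) (at 0)"
  using assms(1)
proof (induction rule: families.induct)
  case (base p f)
  obtain p' where p': "matrix_polynomial p'"
    "\<And>g. ((\<lambda>t. p (transvection i j (- t) ** g)) has_field_derivative p' g) (at 0)"
    using matrix_polynomial_derivative[OF base(1)] by blast
  have "act (transvection i j t) (scal c * act (transvection i j (- t) ** g) f) = scal c * act g f"
    for t c and g :: "complex ^ 'n ^ 'n"
    by (simp add: act_scal act_comp transvection_inverse assms(2))
  then show ?case
    using p' base(2)
    by (intro bexI[of _ "\<lambda>g. scal (p' g) * act g f"] families.base)
      (auto simp: lookup_scal_mult intro!: DERIV_cmult_right)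
next
  case (plus F H)
  then obtain F' H' where *: "F' \<in> families W" "H' \<in> families W"
    "\<And>g w. ((\<lambda>t. lookup (act (transvection i j t) (F (transvection i j (- t) ** g))) w)
      has_field_derivative lookup (F' g) w) (at 0)"
    "\<And>g w. ((\<lambda>t. lookup (act (transvection i j t) (H (transvection i j (- t) ** g))) w)
      has_field_derivative lookup (H' g) w) (at 0)"
    by blast
  then show ?case
    by (intro bexI[of _ "\<lambda>g. F' g + H' g"] families.plus)
      (auto simp: act_add lookup_add intro!: DERIV_add)
qed

lemma (in quadratic_quotient) families_polynomial:
  assumes "F \<in> families W"
  shows "matrix_polynomial (\<lambda>g. lookup (nf (F g)) v)"
  using assms
proof (induction rule: families.induct)
  case (base p f)
  then show ?case
    by (simp add: nf_scal lookup_scal_mult matrix_polynomial.mult matrix_polynomial_nf_act)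
next
  case (plus F H)
  then show ?case by (simp add: nf_add lookup_add matrix_polynomial.add)
qed

section \<open>Generic initial words\<close>

context ordered_quotient
begin

lemma finite_max_word:
  assumes "finite A" "A \<noteq> {}"
  shows "\<exists>m\<in>A. \<forall>x\<in>A. \<not> word_lt m x"
  using assms
proof (induction rule: finite_ne_induct)
  case (singleton x)
  show ?case using lt_irrefl by auto
next
  case (insert x A)
  then obtain m where m: "m \<in> A" "\<forall>y\<in>A. \<not> word_lt m y" by blast
  show ?case
  proof (cases "word_lt m x")
    case True
    then have "\<not> word_lt x y" if "y \<in> A" for y using m(2) that lt_trans by blast
    with lt_irrefl show ?thesis by auto
  next
    case False
    with m show ?thesis by auto
  qed
qed

lemma std_comparable: "std v \<Longrightarrow> std w \<Longrightarrow> v \<noteq> w \<Longrightarrow> word_lt v w \<or> word_lt w v"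
  using lt_linear std_mset_inj by blast

lemma initial_word_exists:
  assumes "nf f \<noteq> 0"
  shows "\<exists>w. initial_word word_lt (nf f) w"
proof -
  have "keys (nf f) \<noteq> {}" using assms by simp
  then obtain m where m: "m \<in> keys (nf f)" "\<forall>x\<in>keys (nf f). \<not> word_lt m x"
    using finite_max_word[OF finite_keys] by blast
  then have "word_lt x m" if "x \<in> keys (nf f)" "x \<noteq> m" for x
    using std_comparable[of x m] keys_nf that by blast
  with m(1) show ?thesis by (auto simp: initial_word_def)
qed

lemma initial_word_unique: "initial_word word_lt f v \<Longrightarrow> initial_word word_lt f w \<Longrightarrow> v = w"
  using lt_asym by (metis initial_word_def)

text \<open>The word \<open>v\<close> is the largest one whose coefficient does not vanish identically on the family. For
  special matrices the leading word may be smaller.\<close>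

definition generic_lead :: "(((complex, 'n) vec, 'n) vec \<Rightarrow> 'n free_alg) \<Rightarrow> 'n list \<Rightarrow> bool" where
  "generic_lead F v \<longleftrightarrow> (\<exists>g. lookup (nf (F g)) v \<noteq> 0) \<and>
     (\<forall>u g. u \<noteq> v \<longrightarrow> lookup (nf (F g)) u \<noteq> 0 \<longrightarrow> word_lt u v)"

definition generic_words :: "'n free_alg set \<Rightarrow> 'n list set" where
  "generic_words W = {v. \<exists>F\<in>families W. generic_lead F v}"

lemma generic_lead_std: "generic_lead F v \<Longrightarrow> std v"
  using keys_nf by (auto simp: generic_lead_def in_keys_iff)

lemma generic_lead_initial_word:
  "generic_lead F v \<Longrightarrow> lookup (nf (F g)) v \<noteq> 0 \<Longrightarrow> initial_word word_lt (nf (F g)) v"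
  by (auto simp: generic_lead_def initial_word_def in_keys_iff)

context
  fixes W :: "'n free_alg set" and d
  assumes W: "free_alg.subspace W" and deg: "\<And>f. f \<in> W \<Longrightarrow> keys f \<subseteq> words d"
begin

lemma families_words: "F \<in> families W \<Longrightarrow> keys (nf (F g)) \<subseteq> words d"
  using families_value[OF W, of F g] deg keys_nf_words keys_act by metis

lemma generic_lead_exists:
  assumes F: "F \<in> families W" and nz: "lookup (nf (F g)) u \<noteq> 0"
  shows "\<exists>v. generic_lead F v"
proof -
  define A where "A = {v. \<exists>g. lookup (nf (F g)) v \<noteq> 0}"
  have "A \<subseteq> words d"
  proof
    fix x assume "x \<in> A"
    then obtain g where "x \<in> keys (nf (F g))" by (auto simp: A_def in_keys_iff)
    with families_words[OF F] show "x \<in> words d" by blast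
  qed
  then have "finite A" using finite_words finite_subset by blast
  moreover have "A \<noteq> {}" using nz by (auto simp: A_def)
  ultimately obtain m where m: "m \<in> A" "\<forall>x\<in>A. \<not> word_lt m x" using finite_max_word by blast
  have std: "std x" if "x \<in> A" for x using that keys_nf by (auto simp: A_def in_keys_iff)
  have "word_lt x m" if "x \<in> A" "x \<noteq> m" for x
    using std_comparable[OF std std] m that by blast
  with m(1) have "generic_lead F m" by (auto simp: generic_lead_def A_def)
  then show ?thesis ..
qed

lemma generic_words_subset: "generic_words W \<subseteq> words d"
  using families_words by (fastforce simp: generic_words_def generic_lead_def in_keys_iff)

lemma finite_generic_words: "finite (generic_words W)"
  using generic_words_subset finite_words finite_subset by blast

text \<open>Let \<open>v\<close> be the generic leading word of \<open>F\<close>. If the coefficient of \<open>v\<close> in \<open>F\<close> does not vanish at \<open>g\<close>,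
  the initial word at \<open>g\<close> is \<open>v\<close>. Otherwise the cross-multiplied difference of \<open>F\<close> and the chosen
  family \<open>L v\<close> has a smaller generic leading word, while at \<open>g\<close> it is a non-zero multiple of \<open>F g\<close>
  and has the same initial word.\<close>

lemma elimination:
  assumes L: "\<And>v. v \<in> generic_words W \<Longrightarrow> L v \<in> families W \<and> generic_lead (L v) v"
    and g: "\<And>v. v \<in> generic_words W \<Longrightarrow> lookup (nf (L v g)) v \<noteq> 0"
    and "generic_lead F v" "F \<in> families W" "initial_word word_lt (nf (F g)) w"
  shows "w \<in> generic_words W"
  using assms(3-5)
proof (induction "mset v" arbitrary: F v rule: wfp_induct_rule[OF lt_wf])
  case (1 v F)
  have v: "v \<in> generic_words W" using 1 by (auto simp: generic_words_def)
  show ?case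
  proof (cases "lookup (nf (F g)) v = 0")
    case False
    with 1(2) have "initial_word word_lt (nf (F g)) v" by (rule generic_lead_initial_word)
    with 1(4) have "w = v" by (rule initial_word_unique)
    with v show ?thesis by simp
  next
    case True
    define F' where
      "F' h = scal (lookup (nf (L v h)) v) * F h - scal (lookup (nf (F h)) v) * L v h" for h
    have F': "F' \<in> families W"
      unfolding F'_def[abs_def]
      by (intro families_diff families_scale families_polynomial[where W = W] 1(3))
        (use L[OF v] in auto)
    have lookup: "lookup (nf (F' h)) u =
        lookup (nf (L v h)) v * lookup (nf (F h)) u - lookup (nf (F h)) v * lookup (nf (L v h)) u" for h u
      by (simp add: F'_def nf_diff nf_scal lookup_minus lookup_scal_mult)
    have below: "word_lt u v" if "lookup (nf (F' h)) u \<noteq> 0" for h u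
    proof -
      from that have "lookup (nf (F h)) u \<noteq> 0 \<or> lookup (nf (L v h)) u \<noteq> 0" "u \<noteq> v"
        by (auto simp: lookup)
      then show ?thesis using 1(2) L[OF v] by (auto simp: generic_lead_def)
    qed
    let ?c = "lookup (nf (L v g)) v"
    have eq: "lookup (nf (F' g)) u = ?c * lookup (nf (F g)) u" for u using True by (simp add: lookup)
    have init: "initial_word word_lt (nf (F' g)) w"
      using 1(4) g[OF v] by (simp add: initial_word_def in_keys_iff eq Ball_def)
    then have "lookup (nf (F' g)) w \<noteq> 0" by (simp add: initial_word_def in_keys_iff)
    then obtain v' where v': "generic_lead F' v'" using generic_lead_exists[OF F'] by blast
    then have "word_lt v' v" using below by (auto simp: generic_lead_def)
    from 1(1)[OF this v' F' init] show ?thesis .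
  qed
qed

text \<open>The polynomial \<open>s\<close> is the product of the leading coefficients of one chosen family for each generic
  word. Where it does not vanish, these families realise all generic words, and elimination shows
  that no others occur.\<close>

lemma generic_initial_words:
  "\<exists>s. matrix_polynomial s \<and> (\<exists>g. s g \<noteq> 0) \<and>
     (\<forall>g. s g \<noteq> 0 \<longrightarrow> initial_words W g = generic_words W)"
proof -
  have "\<forall>v\<in>generic_words W. \<exists>F. F \<in> families W \<and> generic_lead F v" by (auto simp: generic_words_def)
  then obtain L where L: "\<forall>v\<in>generic_words W. L v \<in> families W \<and> generic_lead (L v) v"
    by (rule bchoice[THEN exE])
  define c where "c v g = lookup (nf (L v g)) v" for v g
  define s where "s g = (\<Prod>v\<in>generic_words W. c v g)" for g
  have c: "matrix_polynomial (c v)" "\<exists>g. c v g \<noteq> 0" if "v \<in> generic_words W" for v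
    using families_polynomial[of "L v" W v] L that by (auto simp: c_def[abs_def] generic_lead_def)
  have s0: "s g \<noteq> 0 \<longleftrightarrow> (\<forall>v\<in>generic_words W. c v g \<noteq> 0)" for g
    by (simp add: s_def finite_generic_words)
  have "matrix_polynomial s"
    unfolding s_def[abs_def] using c(1) by (intro matrix_polynomial_prod) auto
  moreover have "\<exists>g. s g \<noteq> 0"
  proof (rule generic_matrix[of "c ` generic_words W"])
    show "countable (c ` generic_words W)"
      using finite_generic_words by (intro countable_finite finite_imageI)
    fix g assume "\<And>p. p \<in> c ` generic_words W \<Longrightarrow> p g \<noteq> 0"
    then show "\<exists>g. s g \<noteq> 0" by (auto simp: s0)
  qed (use c in auto)
  moreover have "initial_words W g = generic_words W" if "s g \<noteq> 0" for g
  proof (intro equalityI subsetI)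
    fix w assume "w \<in> initial_words W g"
    then obtain f where f: "f \<in> W" "initial_word word_lt (nf (act g f)) w"
      by (auto simp: initial_words_def)
    have F: "(\<lambda>g. act g f) \<in> families W" using f(1) by (rule families_act)
    moreover obtain v where "generic_lead (\<lambda>g. act g f) v"
      using generic_lead_exists[OF F, of g w] f(2) by (auto simp: initial_word_def in_keys_iff)
    ultimately show "w \<in> generic_words W"
      using elimination[of L g "\<lambda>g. act g f" v w] L that f(2) by (simp add: s0 c_def)
  next
    fix v assume v: "v \<in> generic_words W"
    then have "c v g \<noteq> 0" using that by (simp add: s0)
    then have "initial_word word_lt (nf (L v g)) v"
      using L v by (intro generic_lead_initial_word) (auto simp: c_def)
    moreover obtain f where "f \<in> W" "L v g = act g f" using families_value[OF W] L v by blast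
    ultimately show "v \<in> initial_words W g" by (auto simp: initial_words_def)
  qed
  ultimately show ?thesis by blast
qed

lemma finite_initial_words: "finite (initial_words W g)"
proof (rule finite_subset[OF _ finite_words])
  show "initial_words W g \<subseteq> words d"
  proof
    fix w assume "w \<in> initial_words W g"
    then obtain f where "f \<in> W" "w \<in> keys (nf (act g f))"
      by (auto simp: initial_words_def initial_word_def)
    then show "w \<in> words d" using keys_nf_words[OF keys_act[OF deg]] by blast
  qed
qed

text \<open>The number of initial words is the dimension of the image of $g(W)$ in the quotient, which does not
  depend on \<open>g\<close>. Concretely, elements \<open>b w\<close> realising the initial words at \<open>h\<close> span \<open>W\<close> modulo \<open>I\<close>,
  so their images under \<open>g\<close> span as well, and elements realising the initial words at \<open>g\<close> are
  linearly independent.\<close>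

lemma card_initial_words_le:
  assumes g: "g \<in> GL" and h: "h \<in> GL"
  shows "card (initial_words W g) \<le> card (initial_words W h)"
proof -
  have "\<forall>w. \<exists>f. w \<in> initial_words W h \<longrightarrow> f \<in> W \<and> initial_word word_lt (nf (act h f)) w"
    by (auto simp: initial_words_def)
  then obtain b where b: "\<And>w. w \<in> initial_words W h \<Longrightarrow> b w \<in> W \<and> initial_word word_lt (nf (act h (b w))) w"
    by metis
  have "\<forall>w. \<exists>f. w \<in> initial_words W g \<longrightarrow> f \<in> W \<and> initial_word word_lt (nf (act g f)) w"
    by (auto simp: initial_words_def)
  then obtain b' where b': "\<And>w. w \<in> initial_words W g \<Longrightarrow> b' w \<in> W \<and> initial_word word_lt (nf (act g (b' w))) w"
    by metis
  obtain h' where h': "h ** h' = mat 1" "h' ** h = mat 1" using h by (rule GL_inverse)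
  define B where "B = (\<lambda>w. nf (act g (b w))) ` initial_words W h"
  \<comment> \<open>reduction by the elements \<open>b v\<close>, by induction on the initial word at \<open>h\<close>\<close>
  have span: "nf (act g f) \<in> free_alg.span B" if "f \<in> W" for f
  proof (cases "nf (act h f) = 0")
    case True
    then have "nf (act h' (act h f)) = nf (act h' 0)" by (intro nf_act_cong) (simp add: nf_0)
    then have "nf f = nf 0" by (simp add: act_comp h' act_mat_1 act_0)
    then have "nf (act g f) = nf (act g 0)" by (rule nf_act_cong)
    then show ?thesis by (simp add: act_0 nf_0 free_alg.span_zero)
  next
    case False
    then obtain v where "initial_word word_lt (nf (act h f)) v" using initial_word_exists by blast
    with that show ?thesis
    proof (induction "mset v" arbitrary: f v rule: wfp_induct_rule[OF lt_wf])
      case (1 v f)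
      have v: "v \<in> initial_words W h" using 1 by (auto simp: initial_words_def)
      let ?F = "nf (act h f)" and ?B = "nf (act h (b v))"
      define c where "c = lookup ?F v / lookup ?B v"
      define f' where "f' = f - scal c * b v"
      have f': "f' \<in> W"
        unfolding f'_def using 1(2) b[OF v] by (intro free_alg.subspace_diff free_alg.subspace_scale W) auto
      have lookup: "lookup (nf (act h f')) u = lookup ?F u - c * lookup ?B u" for u
        by (simp add: f'_def act_diff act_scal nf_diff nf_scal lookup_minus lookup_scal_mult)
      have "lookup ?B v \<noteq> 0" using b[OF v] by (simp add: initial_word_def in_keys_iff)
      then have "lookup (nf (act h f')) v = 0" by (simp add: lookup c_def)
      then have below: "word_lt u v" if "lookup (nf (act h f')) u \<noteq> 0" for u
        using that 1(3) b[OF v] by (cases "u = v") (auto simp: lookup initial_word_def in_keys_iff)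
      have "nf (act g f') \<in> free_alg.span B"
      proof (cases "nf (act h f') = 0")
        case True
        then have "nf (act h' (act h f')) = nf (act h' 0)" by (intro nf_act_cong) (simp add: nf_0)
        then have "nf f' = nf 0" by (simp add: act_comp h' act_mat_1 act_0)
        then have "nf (act g f') = nf (act g 0)" by (rule nf_act_cong)
        then show ?thesis by (simp add: act_0 nf_0 free_alg.span_zero)
      next
        case False
        then obtain u where u: "initial_word word_lt (nf (act h f')) u" using initial_word_exists by blast
        then have "word_lt u v" using below by (simp add: initial_word_def in_keys_iff)
        from 1(1)[OF this f' u] show ?thesis .
      qed
      moreover have "nf (act g (b v)) \<in> free_alg.span B"
        using v by (intro free_alg.span_base) (simp add: B_def)
      moreover have "nf (act g f) = nf (act g f') + scal c * nf (act g (b v))"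
        by (simp add: f'_def act_diff act_scal nf_diff nf_scal)
      ultimately show ?case by (simp only: free_alg.span_add free_alg.span_scale)
    qed
  qed
  let ?V = "initial_words W g" and ?\<phi> = "\<lambda>w. nf (act g (b' w))"
  have inj: "inj_on ?\<phi> ?V"
  proof (rule inj_onI)
    fix v w assume "v \<in> ?V" "w \<in> ?V" "?\<phi> v = ?\<phi> w"
    then have "initial_word word_lt (?\<phi> w) v" "initial_word word_lt (?\<phi> w) w" using b' by metis+
    then show "v = w" by (rule initial_word_unique)
  qed
  \<comment> \<open>in a linear relation the largest leading word with a non-zero coefficient cannot cancel\<close>
  have "free_alg.independent (?\<phi> ` ?V)"
  proof (rule free_alg.independent_if_scalars_zero)
    show "finite (?\<phi> ` ?V)" using finite_initial_words by simp
    fix c x assume zero: "(\<Sum>x\<in>?\<phi> ` ?V. scal (c x) * x) = 0" and x: "x \<in> ?\<phi> ` ?V"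
    show "c x = 0"
    proof (rule ccontr)
      assume "c x \<noteq> 0"
      define A where "A = {w \<in> ?V. c (?\<phi> w) \<noteq> 0}"
      have "A \<noteq> {}" using x \<open>c x \<noteq> 0\<close> by (auto simp: A_def)
      moreover have "finite A" using finite_initial_words by (simp add: A_def)
      ultimately obtain m where m: "m \<in> A" "\<forall>w\<in>A. \<not> word_lt m w" using finite_max_word by blast
      have "c (?\<phi> w) * lookup (?\<phi> w) m = (if w = m then c (?\<phi> m) * lookup (?\<phi> m) m else 0)"
        if "w \<in> ?V" for w
        using m b'[OF that] that by (auto simp: A_def initial_word_def in_keys_iff)
      then have "lookup (\<Sum>w\<in>?V. scal (c (?\<phi> w)) * ?\<phi> w) m =
          (\<Sum>w\<in>?V. if w = m then c (?\<phi> m) * lookup (?\<phi> m) m else 0)"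
        unfolding lookup_sum lookup_scal_mult by (rule sum.cong[OF refl])
      also have "\<dots> = c (?\<phi> m) * lookup (?\<phi> m) m"
        using m(1) by (subst sum.delta[OF finite_initial_words]) (simp add: A_def)
      finally have "lookup (\<Sum>w\<in>?V. scal (c (?\<phi> w)) * ?\<phi> w) m = c (?\<phi> m) * lookup (?\<phi> m) m" .
      moreover have "(\<Sum>w\<in>?V. scal (c (?\<phi> w)) * ?\<phi> w) = 0"
        using zero unfolding sum.reindex[OF inj] o_def .
      ultimately have "c (?\<phi> m) * lookup (?\<phi> m) m = 0" by simp
      moreover have "m \<in> ?V" using m(1) by (simp add: A_def)
      ultimately show False using m(1) b'[of m] by (auto simp: A_def initial_word_def in_keys_iff)
    qed
  qed
  moreover have "?\<phi> ` ?V \<subseteq> free_alg.span B"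
  proof (rule image_subsetI)
    show "?\<phi> w \<in> free_alg.span B" if "w \<in> ?V" for w using span b'[OF that] by blast
  qed
  moreover have "finite B" using finite_initial_words by (simp add: B_def)
  ultimately have "card (?\<phi> ` ?V) \<le> card B" using free_alg.independent_span_bound by blast
  also have "card B \<le> card (initial_words W h)"
    unfolding B_def by (rule card_image_le[OF finite_initial_words])
  finally show ?thesis by (simp add: card_image[OF inj])
qed

text \<open>Strong stability. The derivative \<open>F'\<close> of $u_t F(u_t^{-1} g)$ has two parts: the derivative of the
  coefficients of \<open>F\<close>, which involves only words up to the generic leading word \<open>n\<close>, and the
  derivation that maps $X_j$ to $X_i$, applied to \<open>F\<close>. As $x_j \prec x_i$, the derivation
  produces from \<open>n\<close> the word \<open>v\<close>, which is larger than \<open>n\<close>, and from smaller words only words smaller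
  than \<open>v\<close>. So \<open>v\<close> is the generic leading word of \<open>F'\<close>.\<close>

lemma generic_words_swap:
  assumes n: "n \<in> generic_words W" and j: "j \<in> set n" and ji: "lt {#j#} {#i#}"
    and v: "std v" "mset v = add_mset i (mset n - {#j#})"
  shows "v \<in> generic_words W"
proof -
  have "i \<noteq> j" using ji lt_irrefl by auto
  from n obtain F where F: "F \<in> families W" "generic_lead F n" by (auto simp: generic_words_def)
  obtain F' where F': "F' \<in> families W"
    "\<And>g w. ((\<lambda>t. lookup (act (transvection i j t) (F (transvection i j (- t) ** g))) w)
      has_field_derivative lookup (F' g) w) (at 0)"
    using families_derivative[OF F(1) \<open>i \<noteq> j\<close>] by blast
  define \<phi> where "\<phi> m g = lookup (nf (F g)) m" for m g
  define N where "N = {m \<in> words d. \<exists>g. \<phi> m g \<noteq> 0}"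
  \<comment> \<open>\<open>\<kappa> m u\<close> is the coefficient of \<open>u\<close> in the image of \<open>m\<close> under the derivation\<close>
  define \<kappa> where "\<kappa> m u = sum_list (map (\<lambda>w. if sort w = u then word_sign w else 0) (replace_one i j m))"
    for m u
  have finN: "finite N" by (rule finite_subset[OF _ finite_words[of d]]) (auto simp: N_def)
  have n_pos: "mset n = add_mset j (mset n - {#j#})" using j by simp
  have n_lt_v: "word_lt n v"
    using lt_add[OF ji, of "mset n - {#j#}"] n_pos v(2) by simp
  have N_le: "m = n \<or> word_lt m n" and N_std: "std m" if "m \<in> N" for m
    using that F(2) keys_nf by (auto simp: N_def \<phi>_def generic_lead_def in_keys_iff)
  have \<kappa>_derivative: "((\<lambda>t. lookup (nf (act (transvection i j t) (mon m))) u)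
      has_field_derivative \<kappa> m u) (at 0)" for m u
  proof -
    let ?R = "replace_one i j m" and ?s = "\<lambda>w. if sort w = u then word_sign w else 0"
    have "((\<lambda>t. lookup (nf (act (transvection i j t) (mon m))) u) has_field_derivative
        (\<Sum>w\<in>words (length u). of_nat (count_list ?R w) * ?s w)) (at 0)"
      unfolding lookup_nf by (intro DERIV_sum DERIV_cmult_right derivative_act_mon)
    moreover have "(\<Sum>w\<in>words (length u). of_nat (count_list R w) * ?s w) = sum_list (map ?s R)" for R
    proof (induction R)
      case (Cons x R)
      have "(\<Sum>w\<in>words (length u). of_nat (count_list (x # R) w) * ?s w) =
          (\<Sum>w\<in>words (length u). (if w = x then ?s x else 0) + of_nat (count_list R w) * ?s w)"
        by (rule sum.cong) (auto simp: distrib_right)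
      also have "\<dots> = ?s x + sum_list (map ?s R)"
        using Cons by (auto simp: sum.distrib finite_words) (auto simp: words_def)
      finally show ?case by simp
    qed simp
    ultimately show ?thesis by (simp add: \<kappa>_def)
  qed
  \<comment> \<open>above \<open>n\<close> only the derivation contributes, since the coefficients of \<open>F\<close> vanish there\<close>
  have main: "lookup (nf (F' g)) u = (\<Sum>m\<in>N. \<kappa> m u * \<phi> m g)"
    if u: "std u" "word_lt n u" for u g
  proof -
    let ?u = "\<lambda>t. transvection i j t" and ?h = "\<lambda>t. transvection i j (- t) ** g"
    let ?K = "\<lambda>t. lookup (nf (act (?u t) (F (?h t)))) u"
    have 1: "(?K has_field_derivative lookup (nf (F' g)) u) (at 0)"
      unfolding lookup_nf by (intro DERIV_sum DERIV_cmult_right F'(2))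
    have K: "?K t = (\<Sum>m\<in>N. \<phi> m (?h t) * lookup (nf (act (?u t) (mon m))) u)" for t
    proof -
      have "keys (nf (F (?h t))) \<subseteq> N"
        using families_words[OF F(1), of "?h t"] by (auto simp: N_def \<phi>_def in_keys_iff)
      then have "nf (F (?h t)) = (\<Sum>m\<in>N. scal (\<phi> m (?h t)) * mon m)"
        using lin_ext_superset[OF finN, of "nf (F (?h t))" mon] by (simp add: lin_ext_mon_id \<phi>_def)
      then have "nf (act (?u t) (F (?h t))) = nf (act (?u t) (\<Sum>m\<in>N. scal (\<phi> m (?h t)) * mon m))"
        by (metis nf_act_nf)
      then show ?thesis
        by (simp add: act_sum act_scal nf_sum nf_scal lookup_sum lookup_scal_mult)
    qed
    have "\<forall>m. \<exists>p'. ((\<lambda>t. \<phi> m (?h t)) has_field_derivative p') (at 0)"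
    proof
      fix m
      have "matrix_polynomial (\<phi> m)" unfolding \<phi>_def by (rule families_polynomial[OF F(1)])
      from matrix_polynomial_derivative[OF this, of i j]
      show "\<exists>p'. ((\<lambda>t. \<phi> m (?h t)) has_field_derivative p') (at 0)" by blast
    qed
    then obtain \<phi>' where \<phi>': "\<And>m. ((\<lambda>t. \<phi> m (?h t)) has_field_derivative \<phi>' m) (at 0)" by metis
    have zero: "lookup (nf (act (?u 0) (mon m))) u = 0" if "m \<in> N" for m
    proof -
      have "m \<noteq> u" using N_le[OF that] u(2) lt_irrefl lt_asym by blast
      then show ?thesis
        using N_std[OF that] by (simp add: transvection_0 act_mat_1 nf_mon_std lookup_mon)
    qed
    have "((\<lambda>t. \<Sum>m\<in>N. \<phi> m (?h t) * lookup (nf (act (?u t) (mon m))) u) has_field_derivative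
        (\<Sum>m\<in>N. \<phi>' m * lookup (nf (act (?u 0) (mon m))) u + \<kappa> m u * \<phi> m (?h 0))) (at 0)"
      by (intro DERIV_sum DERIV_mult \<phi>' \<kappa>_derivative)
    moreover have "?h 0 = g" by (simp add: transvection_0)
    ultimately have "(?K has_field_derivative (\<Sum>m\<in>N. \<kappa> m u * \<phi> m g)) (at 0)"
      using zero by (simp add: K)
    from DERIV_unique[OF 1 this] show ?thesis .
  qed
  have \<kappa>_nonzero: "j \<in> set m" "mset u = add_mset i (mset m - {#j#})" if "\<kappa> m u \<noteq> 0" for m u
  proof -
    have "\<exists>w\<in>set (replace_one i j m). sort w = u"
    proof (rule ccontr)
      assume "\<not> ?thesis"
      then have "map (\<lambda>w. if sort w = u then word_sign w else 0) (replace_one i j m) =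
          map (\<lambda>_. 0) (replace_one i j m)" by (intro map_cong) auto
      with that show False by (simp add: \<kappa>_def)
    qed
    then obtain w where w: "w \<in> set (replace_one i j m)" "sort w = u" by blast
    show "j \<in> set m" using w(1) replace_one_Nil[of j m i] by (cases "j \<in> set m") auto
    show "mset u = add_mset i (mset m - {#j#})" using mset_replace_one[OF w(1)] w(2) by auto
  qed
  \<comment> \<open>for \<open>q = 1\<close> this is the exponent of \<open>j\<close> in \<open>n\<close>, for \<open>q = - 1\<close> a sign, as \<open>j\<close> occurs only once\<close>
  have \<kappa>_n: "\<kappa> n v \<noteq> 0"
  proof -
    let ?R = "replace_one i j n"
    have "sort w = v" if "w \<in> set ?R" for w
      using mset_replace_one[OF that] v by (metis sort_eq_iff sort_std)
    then have \<kappa>: "\<kappa> n v = sum_list (map word_sign ?R)"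
      unfolding \<kappa>_def by (intro arg_cong[of _ _ sum_list] map_cong) auto
    show ?thesis
    proof (cases "q = 1")
      case True
      have "sum_list (map word_sign R) = of_nat (length R)" for R
        by (induction R) (auto simp: word_sign_sym[OF True])
      then have "\<kappa> n v = of_nat (length ?R)" by (simp only: \<kappa>)
      then show ?thesis using j by (simp add: length_replace_one)
    next
      case False
      have "std n" using F(2) by (rule generic_lead_std)
      with False have "distinct n" by (simp add: std_def word_sign_nonzero_iff)
      then have "length ?R = 1" using j by (simp add: length_replace_one distinct_count_atmost_1)
      then obtain w where w: "?R = [w]" by (auto simp: length_Suc_conv)
      then have "word_sign w \<noteq> 0"
        using mset_replace_one[of w i j n] v word_sign_mset[of w v] by (auto simp: std_def)
      with w show ?thesis by (simp add: \<kappa>)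
    qed
  qed
  have "generic_lead F' v"
    unfolding generic_lead_def
  proof (intro conjI allI impI)
    have "lookup (nf (F' g)) v = \<kappa> n v * \<phi> n g" for g
    proof -
      have "\<kappa> m v * \<phi> m g = (if m = n then \<kappa> n v * \<phi> n g else 0)" if "m \<in> N" for m
      proof (cases "\<kappa> m v = 0 \<or> m = n")
        case False
        then have "mset m - {#j#} = mset n - {#j#}" "j \<in> set m"
          using \<kappa>_nonzero[of m v] v(2) by auto
        then have "mset m = mset n" using n_pos by (metis insert_DiffM set_mset_mset)
        then have "m = n" using N_std[OF that] generic_lead_std[OF F(2)] std_mset_inj by blast
        with False show ?thesis by simp
      qed auto
      then have "lookup (nf (F' g)) v = (\<Sum>m\<in>N. if m = n then \<kappa> n v * \<phi> n g else 0)"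
        unfolding main[OF v(1) n_lt_v] by (intro sum.cong) auto
      moreover have "n \<in> N"
        using F(2) families_words[OF F(1)] by (fastforce simp: N_def \<phi>_def generic_lead_def in_keys_iff)
      ultimately show ?thesis using finN by simp
    qed
    moreover obtain g where "\<phi> n g \<noteq> 0" using F(2) by (auto simp: generic_lead_def \<phi>_def)
    ultimately show "\<exists>g. lookup (nf (F' g)) v \<noteq> 0" using \<kappa>_n by auto
  next
    fix u g assume u: "u \<noteq> v" "lookup (nf (F' g)) u \<noteq> 0"
    have "std u" using keys_nf u(2) by (simp add: in_keys_iff)
    show "word_lt u v"
    proof (rule ccontr)
      assume "\<not> word_lt u v"
      then have vu: "word_lt v u" using std_comparable[OF \<open>std u\<close> v(1) u(1)] by blast
      then have "word_lt n u" using n_lt_v lt_trans by blast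
      from main[OF \<open>std u\<close> this] u(2) have "(\<Sum>m\<in>N. \<kappa> m u * \<phi> m g) \<noteq> 0" by simp
      then obtain m where "m \<in> N" "\<kappa> m u * \<phi> m g \<noteq> 0"
        by (rule sum.not_neutral_contains_not_neutral)
      then have m: "m \<in> N" "\<kappa> m u \<noteq> 0" by auto
      have "mset u = add_mset i (mset m - {#j#})" "mset m = add_mset j (mset m - {#j#})"
        using \<kappa>_nonzero[OF m(2)] by auto
      then have mu: "add_mset j (mset u) = add_mset i (mset m)" by (metis add_mset_commute)
      have nv: "add_mset j (mset v) = add_mset i (mset n)" using v(2) n_pos by (metis add_mset_commute)
      have "lt (add_mset j (mset v)) (add_mset j (mset u))" using lt_add[OF vu, of "{#j#}"] by simp
      then have "lt (add_mset i (mset n)) (add_mset i (mset m))" by (simp only: mu nv)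
      then have "word_lt n m" using lt_add_cancel[of "{#i#}"] by simp
      with N_le[OF m(1)] show False using lt_irrefl lt_asym by blast
    qed
  qed
  with F'(1) show ?thesis by (auto simp: generic_words_def)
qed

end

end

section \<open>Finite generation of commutative monomial ideals\<close>

lemma nat_seq_incseq_subseq:
  fixes f :: "nat \<Rightarrow> nat"
  shows "\<exists>r :: nat \<Rightarrow> nat. strict_mono r \<and> (\<forall>k l. k \<le> l \<longrightarrow> f (r k) \<le> f (r l))"
proof -
  obtain r where r: "strict_mono r" "monoseq (\<lambda>n. f (r n))" using seq_monosub by blast
  from r(2) consider "\<forall>k l. k \<le> l \<longrightarrow> f (r k) \<le> f (r l)" | "\<forall>k l. k \<le> l \<longrightarrow> f (r l) \<le> f (r k)"
    unfolding monoseq_def by blast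
  then show ?thesis
  proof cases
    case 2
    obtain m where m: "\<And>k. f (r m) \<le> f (r k)"
      using ex_has_least_nat[of "\<lambda>_. True" 0 "\<lambda>n. f (r n)"] by blast
    have eq: "f (r (m + k)) = f (r m)" for k using m[of "m + k"] 2 by (simp add: antisym)
    show ?thesis
    proof (intro exI[of _ "\<lambda>k. r (m + k)"] conjI allI impI)
      show "strict_mono (\<lambda>k. r (m + k))" using r(1) by (simp add: strict_mono_def)
    qed (simp add: eq)
  next
    case 1
    then show ?thesis using r(1) by (intro exI[of _ r] conjI)
  qed
qed

text \<open>Monotone subsequences are extracted for one letter after the other.\<close>

lemma multiset_seq_subseq:
  fixes s :: "nat \<Rightarrow> 'n multiset"
  assumes "finite A"
  shows "\<exists>r :: nat \<Rightarrow> nat. strict_mono r \<and>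
    (\<forall>x\<in>A. \<forall>k l. k \<le> l \<longrightarrow> count (s (r k)) x \<le> count (s (r l)) x)"
  using assms
proof (induction A)
  case empty
  show ?case by (intro exI[of _ id]) (simp add: strict_mono_def)
next
  case (insert x A)
  then obtain r :: "nat \<Rightarrow> nat" where r: "strict_mono r"
    "\<forall>x\<in>A. \<forall>k l. k \<le> l \<longrightarrow> count (s (r k)) x \<le> count (s (r l)) x" by blast
  obtain r' :: "nat \<Rightarrow> nat" where r': "strict_mono r'"
    "\<forall>k l. k \<le> l \<longrightarrow> count (s (r (r' k))) x \<le> count (s (r (r' l))) x"
    using nat_seq_incseq_subseq[of "\<lambda>k. count (s (r k)) x"] by blast
  have "r' k \<le> r' l" if "k \<le> l" for k l using r'(1) that by (simp add: strict_mono_less_eq)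
  with r r' show ?case
    by (intro exI[of _ "r \<circ> r'"]) (auto simp: strict_mono_def)
qed

text \<open>Dickson's lemma. If the elements of length at most \<open>D\<close> were insufficient for every \<open>D\<close>, choose a
  witness \<open>s D\<close> for each. In a subsequence along which all multiplicities increase, the first
  member divides all later ones, among them one whose index is at least the length of the first.\<close>

lemma dickson_words:
  fixes G :: "'n::finite list set"
  shows "\<exists>D. \<forall>w\<in>G. \<exists>v\<in>G. length v \<le> D \<and> mset v \<subseteq># mset w"
proof (rule ccontr)
  assume "\<not> ?thesis"
  then have "\<forall>D. \<exists>w. w \<in> G \<and> (\<forall>v\<in>G. length v \<le> D \<longrightarrow> \<not> mset v \<subseteq># mset w)" by blast
  then obtain s where s: "\<And>D. s D \<in> G" "\<And>D v. v \<in> G \<Longrightarrow> length v \<le> D \<Longrightarrow> \<not> mset v \<subseteq># mset (s D)"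
    by metis
  obtain r :: "nat \<Rightarrow> nat" where r: "strict_mono r"
    "\<forall>x\<in>(UNIV :: 'n set). \<forall>k l. k \<le> l \<longrightarrow> count (mset (s (r k))) x \<le> count (mset (s (r l))) x"
    using multiset_seq_subseq[of UNIV "\<lambda>k. mset (s k)"] by auto
  let ?l = "length (s (r 0))"
  have "?l \<le> r ?l" using r(1) by (rule strict_mono_imp_increasing)
  then have "\<not> mset (s (r 0)) \<subseteq># mset (s (r ?l))" using s by blast
  moreover have "mset (s (r 0)) \<subseteq># mset (s (r ?l))" using r(2) by (simp add: subseteq_mset_def)
  ultimately show False by contradiction
qed

section \<open>Generic initial ideals\<close>

definition homogeneous_part :: "'n free_alg set \<Rightarrow> nat \<Rightarrow> 'n free_alg set" where
  "homogeneous_part a d = {f \<in> a. keys f \<subseteq> words d}"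

lemma subspace_homogeneous_part: "closed_ideal a \<Longrightarrow> free_alg.subspace (homogeneous_part a d)"
  unfolding free_alg.subspace_def homogeneous_part_def
  by (auto intro: closed_ideal_0 closed_ideal_add closed_ideal_left
      simp: in_keys_iff lookup_scal_mult dest!: subsetD[OF keys_add])

lemma homogeneous_ideal_closed: "homogeneous_ideal a \<Longrightarrow> closed_ideal a"
  by (simp add: homogeneous_ideal_def ideal_T_iff)

context ordered_quotient
begin

text \<open>The standard words of the monomials of the generic initial ideal of the image of \<open>a\<close>, assembled
  from the homogeneous parts.\<close>

definition gin_words :: "'n free_alg set \<Rightarrow> 'n list set" where
  "gin_words a = {w. w \<in> generic_words (homogeneous_part a (length w))}"

lemma initial_words_part_iff:
  assumes "homogeneous_ideal a"
  shows "w \<in> initial_words a g \<longleftrightarrow> w \<in> initial_words (homogeneous_part a (length w)) g"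
proof
  assume "w \<in> initial_words a g"
  then obtain f where f: "f \<in> a" "initial_word word_lt (nf (act g f)) w"
    by (auto simp: initial_words_def)
  let ?f = "hom_component (length w) f"
  have "?f \<in> homogeneous_part a (length w)"
    using f(1) assms keys_hom_component[of "length w" f]
    by (simp add: homogeneous_part_def homogeneous_ideal_def)
  moreover have "initial_word word_lt (nf (act g ?f)) w"
    using f(2) by (auto simp: initial_word_def in_keys_iff lookup_nf_act_hom_component split: if_splits)
  ultimately show "w \<in> initial_words (homogeneous_part a (length w)) g"
    by (auto simp: initial_words_def)
qed (auto simp: initial_words_def homogeneous_part_def)

lemma initial_words_part:
  assumes "homogeneous_ideal a"
  shows "initial_words (homogeneous_part a d) g = {w \<in> initial_words a g. length w = d}"
proof -
  have "length w = d" if w: "w \<in> initial_words (homogeneous_part a d) g" for w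
  proof -
    obtain f where f: "keys f \<subseteq> words d" "w \<in> keys (nf (act g f))"
      using w by (auto simp: initial_words_def homogeneous_part_def initial_word_def)
    have "w \<in> words d" using keys_nf_words[OF keys_act[OF f(1)]] f(2) by blast
    then show ?thesis by (simp add: words_def)
  qed
  then show ?thesis using initial_words_part_iff[OF assms] by (auto simp: initial_words_def homogeneous_part_def)
qed

text \<open>One open set has to serve all degrees. It is chosen for the degrees up to a bound \<open>D\<close> for the
  generators of the generic words. There all generic words are initial words, and in each higher
  degree their number is already that of the initial words.\<close>

lemma generic_initial_words_eq:
  assumes a: "homogeneous_ideal a"
  obtains U where "zariski_open U" "U \<noteq> {}" "\<And>g. g \<in> U \<Longrightarrow> initial_words a g = gin_words a"
proof -
  let ?W = "homogeneous_part a"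
  have sub: "free_alg.subspace (?W d)" for d
    by (rule subspace_homogeneous_part[OF homogeneous_ideal_closed[OF a]])
  have deg: "keys f \<subseteq> words d" if "f \<in> ?W d" for f d
    using that by (simp add: homogeneous_part_def)
  have "\<forall>d. \<exists>s. matrix_polynomial s \<and> (\<exists>g. s g \<noteq> 0) \<and>
     (\<forall>g. s g \<noteq> 0 \<longrightarrow> initial_words (?W d) g = generic_words (?W d))"
    using generic_initial_words[OF sub deg] by blast
  then obtain s where s: "\<And>d. matrix_polynomial (s d)" "\<And>d. \<exists>g. s d g \<noteq> 0"
    "\<And>d g. s d g \<noteq> 0 \<Longrightarrow> initial_words (?W d) g = generic_words (?W d)" by metis
  have len: "generic_words (?W d) = {w \<in> gin_words a. length w = d}" for d
    using generic_words_subset[OF sub deg, of d] by (auto simp: gin_words_def words_def)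
  obtain D where D: "\<forall>w\<in>gin_words a. \<exists>v\<in>gin_words a. length v \<le> D \<and> mset v \<subseteq># mset w"
    using dickson_words[of "gin_words a"] by blast
  define U where "U = {g \<in> GL. (\<Prod>d\<le>D. s d g) \<noteq> 0}"
  have "zariski_open U"
    unfolding zariski_open_def U_def
    by (intro exI[of _ "{\<lambda>g. \<Prod>d\<le>D. s d g}"]) (auto intro: matrix_polynomial_prod s)
  moreover have "U \<noteq> {}"
  proof (rule generic_matrix_GL[of "range s"])
    fix g assume "g \<in> GL" "\<And>p. p \<in> range s \<Longrightarrow> p g \<noteq> 0"
    then show "U \<noteq> {}" by (auto simp: U_def)
  qed (use s in auto)
  moreover have "initial_words a g = gin_words a" if g: "g \<in> U" for g
  proof -
    have sg: "s d g \<noteq> 0" if "d \<le> D" for d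
      using g that by (auto simp: U_def)
    have gl: "g \<in> GL" using g by (simp add: U_def)
    have sub_g: "gin_words a \<subseteq> initial_words a g"
    proof
      fix w assume w: "w \<in> gin_words a"
      then obtain v where v: "v \<in> gin_words a" "length v \<le> D" "mset v \<subseteq># mset w" using D by blast
      then have "v \<in> initial_words (?W (length v)) g" using s(3)[OF sg] by (simp add: gin_words_def)
      then have "v \<in> initial_words a g" using initial_words_part_iff[OF a] by blast
      moreover have "std w" using w generic_lead_std by (auto simp: gin_words_def generic_words_def)
      ultimately show "w \<in> initial_words a g"
        using v(3) initial_words_mult[OF homogeneous_ideal_closed[OF a] gl] by blast
    qed
    have "initial_words (?W d) g = generic_words (?W d)" for d
    proof -
      obtain h where h: "h \<in> GL" "s d h \<noteq> 0"
        by (rule generic_matrix_GL[of "{s d}"]) (use s in auto)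
      have "card (initial_words (?W d) g) = card (initial_words (?W d) h)"
        using card_initial_words_le[OF sub deg gl h(1), of d] card_initial_words_le[OF sub deg h(1) gl, of d]
        by (rule antisym)
      then have "card (generic_words (?W d)) = card (initial_words (?W d) g)"
        using s(3)[OF h(2)] by simp
      moreover have "generic_words (?W d) \<subseteq> initial_words (?W d) g"
        using sub_g by (auto simp: len initial_words_part[OF a])
      ultimately show ?thesis
        using card_subset_eq[OF finite_initial_words[OF sub deg]] by metis
    qed
    then show ?thesis using initial_words_part_iff[OF a] by (auto simp: gin_words_def)
  qed
  ultimately show ?thesis by (rule that)
qed

lemma zariski_open_GL: "zariski_open U \<Longrightarrow> U \<subseteq> GL"
  by (auto simp: zariski_open_def)

lemma gin_words_realized:
  assumes "homogeneous_ideal a"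
  obtains g where "g \<in> GL" "initial_words a g = gin_words a"
  using generic_initial_words_eq[OF assms] zariski_open_GL by (metis all_not_in_conv subsetD)

lemma gin_Q_eq:
  assumes "homogeneous_ideal a"
  shows "gin_Q I std lt (proj I ` a) = proj I ` multiples (gin_words a)"
proof -
  obtain U where U: "zariski_open U" "U \<noteq> {}" "\<And>g. g \<in> U \<Longrightarrow> initial_words a g = gin_words a"
    by (rule generic_initial_words_eq[OF assms]) blast
  have init: "init_Q I std lt (quot_act g ` proj I ` a) = proj I ` multiples (gin_words a)" if "g \<in> U" for g
    using init_Q_eq U(3)[OF that] zariski_open_GL[OF U(1)] that by auto
  show ?thesis
    unfolding gin_Q_def
  proof (rule the_equality)
    show "\<exists>U. zariski_open U \<and> U \<noteq> {} \<and>
        (\<forall>g\<in>U. init_Q I std lt (quot_act g ` proj I ` a) = proj I ` multiples (gin_words a))"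
      using U init by blast
    fix J assume "\<exists>U. zariski_open U \<and> U \<noteq> {} \<and> (\<forall>g\<in>U. init_Q I std lt (quot_act g ` proj I ` a) = J)"
    then obtain V where V: "zariski_open V" "V \<noteq> {}"
      "\<forall>g\<in>V. init_Q I std lt (quot_act g ` proj I ` a) = J" by blast
    have "GL \<inter> \<Inter>{U, V} \<noteq> {}" using U V by (intro zariski_open_Inter_nonempty) auto
    then obtain g where "g \<in> U" "g \<in> V" by auto
    then show "J = proj I ` multiples (gin_words a)" using V(3) init by metis
  qed
qed

lemma gin_T_eq:
  assumes a: "homogeneous_ideal a" and Ia: "I \<subseteq> a"
    and ord: "\<And>v w. std w \<Longrightarrow> v \<noteq> w \<Longrightarrow> word_sign v \<noteq> 0 \<Longrightarrow> ord v w \<Longrightarrow> word_lt v w"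
      "\<And>v w. std v \<Longrightarrow> std w \<Longrightarrow> word_lt v w \<Longrightarrow> ord v w"
      "\<And>w. word_sign w \<noteq> 0 \<Longrightarrow> \<not> sorted w \<Longrightarrow> ord (sort w) w"
  shows "gin_T ord a = Idl\<^bsub>T\<^esub> (mon ` (gin_words a \<union> {w. \<not> std w}))" (is "_ = ?J")
proof -
  obtain U where U: "zariski_open U" "U \<noteq> {}" "\<And>g. g \<in> U \<Longrightarrow> initial_words a g = gin_words a"
    by (rule generic_initial_words_eq[OF a]) blast
  have init: "init_T ord (act g ` a) = ?J" if "g \<in> U" for g
  proof -
    have "g \<in> GL" using zariski_open_GL[OF U(1)] that by blast
    from init_T_eq[OF Ia homogeneous_ideal_closed[OF a] this, of ord] ord U(3)[OF that]
    show ?thesis by simp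
  qed
  show ?thesis
    unfolding gin_T_def
  proof (rule the_equality)
    show "\<exists>\<U>. countable \<U> \<and> (\<forall>U\<in>\<U>. zariski_open U \<and> U \<noteq> {}) \<and>
        (\<forall>g\<in>GL \<inter> \<Inter>\<U>. init_T ord (act g ` a) = ?J)"
      using U init by (intro exI[of _ "{U}"]) auto
    fix J assume "\<exists>\<U>. countable \<U> \<and> (\<forall>U\<in>\<U>. zariski_open U \<and> U \<noteq> {}) \<and>
        (\<forall>g\<in>GL \<inter> \<Inter>\<U>. init_T ord (act g ` a) = J)"
    then obtain \<V> where V: "countable \<V>" "\<forall>U\<in>\<V>. zariski_open U \<and> U \<noteq> {}"
      "\<forall>g\<in>GL \<inter> \<Inter>\<V>. init_T ord (act g ` a) = J" by blast
    have "GL \<inter> \<Inter>(insert U \<V>) \<noteq> {}" using U V by (intro zariski_open_Inter_nonempty) auto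
    then obtain g where "g \<in> GL" "g \<in> U" "g \<in> \<Inter>\<V>" by auto
    then show "J = ?J" using V(3) init by (metis IntI)
  qed
qed

section \<open>Minimal generators\<close>

lemma std_factor: "factor s w \<Longrightarrow> std w \<Longrightarrow> std s"
  using word_sign_submset[OF factor_mset] by (auto simp: std_def factor_def sorted_append)

lemma std_Cons_Cons:
  assumes "std [x, y]" "std (y # w)"
  shows "std (x # y # w)"
proof -
  have "x \<le> y" "q = 1 \<or> x \<noteq> y" "sorted (y # w)" "q = 1 \<or> distinct (y # w)"
    using assms word_sign_nonzero_iff[of "[x, y]"] word_sign_nonzero_iff[of "y # w"]
    by (auto simp: std_def simp del: word_sign.simps)
  then have "sorted (x # y # w)" "q = 1 \<or> distinct (x # y # w)"
    by (auto intro: order_trans)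
  then show ?thesis using word_sign_nonzero_iff[of "x # y # w"] by (simp add: std_def del: word_sign.simps)
qed

text \<open>Being standard is a condition on neighbouring letters.\<close>

lemma not_std_factor: "\<not> std w \<Longrightarrow> \<exists>i j. \<not> std [i, j] \<and> factor [i, j] w"
proof (induction w rule: induct_list012)
  case (3 x y w)
  show ?case
  proof (cases "std [x, y]")
    case True
    with 3 std_Cons_Cons obtain i j where "\<not> std [i, j]" "factor [i, j] (y # w)" by blast
    moreover have "factor (y # w) (x # y # w)" unfolding factor_def by (metis append_Cons append_Nil append_Nil2)
    ultimately show ?thesis using factor_trans by blast
  next
    case False
    moreover have "factor [x, y] (x # y # w)" unfolding factor_def by (metis append_Cons append_Nil)
    ultimately show ?thesis by blast
  qed
qed (simp_all add: std_def)

context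
  fixes a :: "'n free_alg set"
  assumes a: "homogeneous_ideal a"
begin

lemma gin_words_std: "w \<in> gin_words a \<Longrightarrow> std w"
  using generic_lead_std by (auto simp: gin_words_def generic_words_def)

lemma gin_words_mult: "w \<in> gin_words a \<Longrightarrow> std v \<Longrightarrow> mset w \<subseteq># mset v \<Longrightarrow> v \<in> gin_words a"
  using initial_words_mult[OF homogeneous_ideal_closed[OF a]] gin_words_realized[OF a] by metis

lemma gin_words_swap:
  assumes n: "n \<in> gin_words a" and j: "j \<in> set n" and ji: "lt {#j#} {#i#}"
    and v: "std v" "mset v = add_mset i (mset n - {#j#})"
  shows "v \<in> gin_words a"
proof -
  have "size (mset v) = size (mset n)" using j v(2) by (simp add: size_Diff_singleton) (metis Suc_pred size_mset length_pos_if_in_set)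
  then have "length v = length n" by simp
  moreover have "v \<in> generic_words (homogeneous_part a (length n))"
  proof (rule generic_words_swap[where d = "length n", OF _ _ _ j ji v])
    show "free_alg.subspace (homogeneous_part a (length n))"
      by (rule subspace_homogeneous_part[OF homogeneous_ideal_closed[OF a]])
    show "n \<in> generic_words (homogeneous_part a (length n))" using n by (simp add: gin_words_def)
  qed (simp add: homogeneous_part_def)
  ultimately show ?thesis by (simp add: gin_words_def)
qed

text \<open>A unit in \<open>a\<close>, that is a non-zero constant, would produce the linear forms $X_i$ in \<open>a\<close>.\<close>

lemma gin_words_length:
  assumes lin: "\<forall>f\<in>a. linear_form f \<longrightarrow> f = 0" and w: "w \<in> gin_words a"
  shows "2 \<le> length w"
proof (rule ccontr)
  assume short: "\<not> 2 \<le> length w"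
  obtain g where "g \<in> GL" "initial_words a g = gin_words a" using gin_words_realized[OF a] .
  with w have "w \<in> initial_words (homogeneous_part a (length w)) g"
    using initial_words_part_iff[OF a] by blast
  then obtain f where f: "f \<in> a" "keys f \<subseteq> words (length w)" "w \<in> keys (nf (act g f))"
    by (auto simp: initial_words_def homogeneous_part_def initial_word_def)
  have "f \<noteq> 0" using f(3) by (auto simp: act_0 nf_0)
  have "length w = 0 \<or> length w = 1" using short by linarith
  then show False
  proof
    assume "length w = 1"
    then have "linear_form f" using f(2) by (auto simp: linear_form_def words_def)
    with lin f(1) \<open>f \<noteq> 0\<close> show False by blast
  next
    assume "length w = 0"
    then have keys: "keys f \<subseteq> {[]}" using f(2) by (auto simp: words_def)
    have "f = lin_ext mon f" by (simp add: lin_ext_mon_id)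
    also have "\<dots> = scal (lookup f [])"
      using lin_ext_superset[of "{[]}" f mon] keys by (simp add: mon_Nil)
    finally have f_eq: "f = scal (lookup f [])" .
    fix i :: 'n
    have Xf: "f * X i = scal (lookup f []) * mon [i]" using f_eq X_def by metis
    have "linear_form (f * X i)"
      unfolding Xf by (auto simp: linear_form_def in_keys_iff lookup_scal_mon split: if_splits)
    moreover have "f * X i \<in> a" by (rule closed_ideal_right[OF homogeneous_ideal_closed[OF a] f(1)])
    ultimately have "scal (lookup f []) * mon [i] = 0" using lin Xf by metis
    then have "lookup (scal (lookup f []) * mon [i]) [i] = 0" by (simp only: lookup_zero)
    then have "lookup f [] = 0" by (simp add: lookup_scal_mon)
    with f_eq \<open>f \<noteq> 0\<close> show False by (simp add: scal_0)
  qed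
qed

text \<open>Divisibility by \<open>v\<close> allows one letter \<open>x\<close> of \<open>w\<close> to be removed. If \<open>x\<close> lies strictly between the
  first letter \<open>b\<close> and the last letter \<open>c\<close>, then by compatibility with the numbering it is larger than
  \<open>b\<close> or than \<open>c\<close> in the order on the variables. Strong stability trades that letter for \<open>x\<close>, with
  the effect that the first or the last letter is removed instead of \<open>x\<close>.\<close>

lemma gin_words_shorten:
  assumes compat: "numbering_compatible lt"
    and w: "w \<in> gin_words a" and v: "v \<in> gin_words a" "mset v \<subseteq># mset w" "v \<noteq> w"
  shows "tl w \<in> gin_words a \<or> butlast w \<in> gin_words a"
proof -
  have std: "std w" using w by (rule gin_words_std)
  have "mset v \<noteq> mset w" using std_mset_inj gin_words_std w v by blast
  then obtain x where x: "x \<in># mset w - mset v"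
    using v(2) by (metis Diff_eq_empty_iff_mset multiset_nonemptyE subset_mset.order_antisym)
  then have xw: "x \<in> set w" by (metis in_diffD set_mset_mset)
  define w' where "w' = remove1 x w"
  have w'_mset: "mset w' = mset w - {#x#}" by (simp add: w'_def)
  have w'_std: "std w'"
    using std word_sign_submset[of w' w] by (auto simp: std_def w'_def sorted_remove1)
  have "mset v \<subseteq># mset w'"
    unfolding w'_mset subseteq_mset_def
  proof
    fix y
    show "count (mset v) y \<le> count (mset w - {#x#}) y"
      using mset_subset_eq_count[OF v(2), of y] x by (cases "y = x") (auto simp: in_diff_count)
  qed
  with v(1) w'_std have w': "w' \<in> gin_words a" using gin_words_mult by blast
  have "w \<noteq> []" using xw by auto
  define b c where "b = hd w" and "c = last w"
  have bw: "w = b # tl w" and cw: "w = butlast w @ [c]" using \<open>w \<noteq> []\<close> by (simp_all add: b_def c_def)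
  have tl_mset: "mset w = add_mset b (mset (tl w))" by (subst bw) simp
  have bl_mset: "mset w = add_mset c (mset (butlast w))" by (subst cw) simp
  have "factor (tl w) w" "factor (butlast w) w"
    unfolding factor_def using bw cw by (metis append_Cons append_Nil append_Nil2)+
  then have tl_std: "std (tl w)" and bl_std: "std (butlast w)" using std std_factor by blast+
  have "b \<le> x" using std xw bw by (metis set_ConsD sorted_simps(2) std_def order_refl)
  have "x \<le> c"
  proof -
    have "sorted (butlast w @ [c])" using std cw by (simp add: std_def)
    moreover have "x \<in> set (butlast w @ [c])" using xw cw by simp
    ultimately show ?thesis by (auto simp: sorted_append)
  qed
  consider "x = b" | "x = c" | "b < x" "x < c" using \<open>b \<le> x\<close> \<open>x \<le> c\<close> by fastforce
  then show ?thesis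
  proof cases
    case 1
    then have "mset (tl w) = mset w'" using tl_mset w'_mset by simp
    with tl_std w'_std w' show ?thesis using std_mset_inj by metis
  next
    case 2
    then have "mset (butlast w) = mset w'" using bl_mset w'_mset by simp
    with bl_std w'_std w' show ?thesis using std_mset_inj by metis
  next
    case 3
    with compat consider "lt {#b#} {#x#}" | "lt {#c#} {#x#}" unfolding numbering_compatible_def by blast
    then show ?thesis
    proof cases
      case 1
      have "x \<in># add_mset b (mset (tl w))" using xw by (simp flip: tl_mset)
      then have "x \<in># mset (tl w)" using 3 by auto
      then have "mset (tl w) = add_mset x (mset w' - {#b#})"
        unfolding w'_mset tl_mset using 3 by auto
      moreover have "b \<in> set w'"
        using 3 in_set_remove1[of b x w] hd_in_set[OF \<open>w \<noteq> []\<close>] by (auto simp: w'_def b_def)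
      ultimately show ?thesis using gin_words_swap[OF w' _ 1 tl_std] by blast
    next
      case 2
      have "x \<in># add_mset c (mset (butlast w))" using xw by (simp flip: bl_mset)
      then have "x \<in># mset (butlast w)" using 3 by auto
      then have "mset (butlast w) = add_mset x (mset w' - {#c#})"
        unfolding w'_mset bl_mset using 3 by auto
      moreover have "c \<in> set w'"
        using 3 in_set_remove1[of c x w] last_in_set[OF \<open>w \<noteq> []\<close>] by (auto simp: w'_def c_def)
      ultimately show ?thesis using gin_words_swap[OF w' _ 2 bl_std] by blast
    qed
  qed
qed

lemma gin_words_minimal_factor:
  assumes compat: "numbering_compatible lt" and "w \<in> gin_words a"
  shows "\<exists>m\<in>minimal_words (gin_words a). factor m w"
  using assms(2)
proof (induction w rule: measure_induct_rule[of length])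
  case (less w)
  show ?case
  proof (cases "w \<in> minimal_words (gin_words a)")
    case True
    then show ?thesis using factor_refl by blast
  next
    case False
    then obtain v where v: "v \<in> gin_words a" "mset v \<subseteq># mset w" "v \<noteq> w"
      using less.prems by (auto simp: minimal_words_def)
    then have "w \<noteq> []" by auto
    from gin_words_shorten[OF compat less.prems v]
    obtain u where u: "u \<in> gin_words a" "u = tl w \<or> u = butlast w" by blast
    have "factor u w"
      unfolding factor_def using u(2) \<open>w \<noteq> []\<close>
      by (metis append_Cons append_Nil append_Nil2 append_butlast_last_id list.collapse)
    moreover have "length u < length w" using u(2) \<open>w \<noteq> []\<close> by (cases w) auto
    ultimately show ?thesis using less.IH[OF _ u(1)] factor_trans by blast
  qed
qed

text \<open>By the existence of minimal factors, the minimal standard words and the non-standard words of length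
  two generate the same monomial ideal as all words of the generic initial ideal. They form an
  antichain for factors: factors of standard words are standard, and generators have length at
  least two because \<open>a\<close> contains no non-zero linear form.\<close>

lemma gin_minimally_generated:
  assumes Ia: "I \<subseteq> a" and compat: "numbering_compatible lt"
    and lin: "\<forall>f\<in>a. linear_form f \<longrightarrow> f = 0"
    and ord: "\<And>v w. std w \<Longrightarrow> v \<noteq> w \<Longrightarrow> word_sign v \<noteq> 0 \<Longrightarrow> ord v w \<Longrightarrow> word_lt v w"
      "\<And>v w. std v \<Longrightarrow> std w \<Longrightarrow> word_lt v w \<Longrightarrow> ord v w"
      "\<And>w. word_sign w \<noteq> 0 \<Longrightarrow> \<not> sorted w \<Longrightarrow> ord (sort w) w"
  shows "minimally_generates T
    (delta I std ` min_gens (T Quot I) (quot_monomials I std) (gin_Q I std lt (proj I ` a))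
      \<union> {X i * X j | i j. \<not> std [i, j]})
    (gin_T ord a)"
proof -
  let ?G = "gin_words a" and ?M = "minimal_words (gin_words a)" and ?P = "{[i, j] | i j. \<not> std [i, j]}"
  have M_std: "std w" if "w \<in> ?M" for w using that gin_words_std by (simp add: minimal_words_def)
  have "delta I std ` min_gens (T Quot I) (quot_monomials I std) (gin_Q I std lt (proj I ` a)) =
      delta I std ` proj I ` mon ` ?M"
    by (simp add: gin_Q_eq[OF a] min_gens_quot[OF gin_words_std])
  also have "\<dots> = mon ` ?M"
    by (auto simp: image_image delta_proj_mon M_std cong: image_cong)
  also have "mon ` ?M \<union> {X i * X j | i j. \<not> std [i, j]} = mon ` (?M \<union> ?P)"
    by (auto simp: image_Un mon_Cons mon_Nil)
      (metis (mono_tags, lifting) image_eqI mem_Collect_eq mon_Cons mon_Nil mult.right_neutral)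
  finally have gens: "delta I std ` min_gens (T Quot I) (quot_monomials I std) (gin_Q I std lt (proj I ` a))
      \<union> {X i * X j | i j. \<not> std [i, j]} = mon ` (?M \<union> ?P)" .
  have "(\<exists>s\<in>?M \<union> ?P. factor s w) \<longleftrightarrow> (\<exists>s\<in>?G \<union> {w. \<not> std w}. factor s w)" for w
  proof
    assume "\<exists>s\<in>?G \<union> {w. \<not> std w}. factor s w"
    then obtain s where s: "s \<in> ?G \<or> \<not> std s" "factor s w" by blast
    from s(1) have "\<exists>t\<in>?M \<union> ?P. factor t s"
      using gin_words_minimal_factor[OF compat] not_std_factor by blast
    with s(2) show "\<exists>s\<in>?M \<union> ?P. factor s w" using factor_trans by blast
  qed (auto simp: minimal_words_def)
  moreover have "gin_T ord a = Idl\<^bsub>T\<^esub> (mon ` (?G \<union> {w. \<not> std w}))"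
    by (rule gin_T_eq[OF a Ia]) (fact ord)+
  ultimately have "Idl\<^bsub>T\<^esub> (mon ` (?M \<union> ?P)) = gin_T ord a"
    unfolding Idl_mon_eq by simp
  then show ?thesis
    unfolding gens
  proof (rule minimally_generates_mon)
    fix s t assume st: "s \<in> ?M \<union> ?P" "t \<in> ?M \<union> ?P" "factor s t"
    have long: "2 \<le> length s" using st(1) gin_words_length[OF lin] by (auto simp: minimal_words_def)
    show "s = t"
    proof (cases "t \<in> ?M")
      case True
      then have "std s" using std_factor[OF st(3)] M_std by blast
      then have "s \<in> ?M" using st(1) by auto
      with True factor_mset[OF st(3)] show ?thesis by (simp add: minimal_words_def)
    next
      case False
      then have "length t = 2" using st(2) by auto
      moreover obtain u v where uv: "t = u @ s @ v" using st(3) by (auto simp: factor_def)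
      ultimately have "length u + length s + length v = 2" by simp
      with long have "length u = 0 \<and> length v = 0" by linarith
      with uv show ?thesis by simp
    qed
  qed
qed

end

end

section \<open>The symmetric and the exterior algebra\<close>

text \<open>At the first position where they differ, the sorted word has the smallest of the remaining
  letters.\<close>

lemma lex_less_sorted:
  "sorted w \<Longrightarrow> mset v = mset w \<Longrightarrow> v \<noteq> w \<Longrightarrow> lex_less w v"
proof (induction w arbitrary: v)
  case (Cons x w)
  then obtain y v' where v: "v = y # v'" by (cases v) auto
  have "y \<in> set (x # w)" using Cons.prems(2) v by (metis list.set_intros(1) mset_eq_setD)
  then have "x \<le> y" using Cons.prems(1) by auto
  show ?case
  proof (cases "x = y")
    case True
    then have "lex_less w v'" using Cons v by auto
    with True v show ?thesis by (simp add: lex_less_def)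
  next
    case False
    with \<open>x \<le> y\<close> v show ?thesis by (simp add: lex_less_def)
  qed
qed simp

lemma not_lex_less_sorted: "sorted w \<Longrightarrow> mset v = mset w \<Longrightarrow> \<not> lex_less v w"
proof
  assume w: "sorted w" "mset v = mset w" "lex_less v w"
  have irr: "\<not> lex_less u u" for u :: "'a list"
    unfolding lex_less_def by (rule lexord_irreflexive) auto
  then have "lex_less w v" using lex_less_sorted w by metis
  moreover have "trans {(i, j :: 'a). i < j}" by (auto intro: transI)
  ultimately have "lex_less w w" using w(3) unfolding lex_less_def by (metis lexord_trans)
  with irr show False by blast
qed

lemma lex_less_sort: "\<not> sorted w \<Longrightarrow> lex_less (sort w) w"
  by (metis lex_less_sorted mset_sort sorted_sort)

lemma quadratic_quotient_comm:
  "quadratic_quotient 1 (comm_ideal :: 'n::{finite,linorder} free_alg set)"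
proof
  show "closed_ideal (comm_ideal :: 'n free_alg set)"
    unfolding comm_ideal_def by (rule closed_ideal_Idl)
  show "X i * X j - scal 1 * (X j * X i) \<in> comm_ideal" if "i < j" for i j :: 'n
    using that Idl_superset[of "{X i * X j - X j * X i | i j :: 'n. i < j}"]
    by (auto simp: comm_ideal_def scal_1)
  fix K :: "'n free_alg set"
  assume K: "closed_ideal K" "\<And>i j. i < j \<Longrightarrow> X i * X j - scal 1 * (X j * X i) \<in> K"
  show "comm_ideal \<subseteq> K"
    unfolding comm_ideal_def by (rule Idl_least) (use K in \<open>auto simp: scal_1\<close>)
qed auto

lemma quadratic_quotient_anticomm:
  "quadratic_quotient (- 1) (anticomm_ideal :: 'n::{finite,linorder} free_alg set)"
proof
  show closed: "closed_ideal (anticomm_ideal :: 'n free_alg set)"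
    unfolding anticomm_ideal_def by (rule closed_ideal_Idl)
  have gen: "X i * X j + X j * X i \<in> anticomm_ideal" if "i \<le> j" for i j :: 'n
    using that Idl_superset[of "{X i * X j + X j * X i | i j :: 'n. i \<le> j}"]
    by (auto simp: anticomm_ideal_def)
  show "X i * X j - scal (- 1) * (X j * X i) \<in> anticomm_ideal" if "i < j" for i j :: 'n
    using gen[of i j] that by (simp add: scal_minus_1)
  show "X i * X i \<in> anticomm_ideal" for i :: 'n
  proof -
    have "(scal (1 + 1) :: 'n free_alg) = 1 + 1" by (simp only: scal_add scal_1)
    then have "scal 2 * (X i * X i) = X i * X i + X i * X i" by (simp add: mult_2)
    with gen[of i i] show ?thesis using closed_ideal_cancel_scal[OF closed, of 2 "X i * X i"] by simp
  qed
  fix K :: "'n free_alg set"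
  assume K: "closed_ideal K" "\<And>i j. i < j \<Longrightarrow> X i * X j - scal (- 1) * (X j * X i) \<in> K"
    "\<And>i. - 1 = (- 1 :: complex) \<Longrightarrow> X i * X i \<in> K"
  have "X i * X j + X j * X i \<in> K" if "i \<le> j" for i j
    using that K closed_ideal_add[OF K(1)] by (cases "i = j") (auto simp: scal_minus_1)
  then show "anticomm_ideal \<subseteq> K"
    unfolding anticomm_ideal_def by (intro Idl_least K(1)) auto
qed auto

theorem theorem3p4:
  fixes a :: "'n::{finite,linorder} free_alg set"
    and lt :: "'n multiset \<Rightarrow> 'n multiset \<Rightarrow> bool"
  assumes "monoid_well_order lt"
    and "numbering_compatible lt"
    and "homogeneous_ideal a"
    and "\<forall>f\<in>a. linear_form f \<longrightarrow> f = 0"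
  shows
    "(comm_ideal \<subseteq> a \<longrightarrow>
        minimally_generates T
          (delta comm_ideal sym_word `
             min_gens (T Quot comm_ideal) (quot_monomials comm_ideal sym_word)
               (gin_Q comm_ideal sym_word lt (proj comm_ideal ` a))
           \<union> {X i * X j | i j. i > j})
          (gin_T (sym_word_order lt) a)) \<and>
     (anticomm_ideal \<subseteq> a \<longrightarrow>
        minimally_generates T
          (delta anticomm_ideal ext_word `
             min_gens (T Quot anticomm_ideal) (quot_monomials anticomm_ideal ext_word)
               (gin_Q anticomm_ideal ext_word lt (proj anticomm_ideal ` a))
           \<union> {X i * X j | i j. i \<ge> j})
          (gin_T (ext_word_order lt) a))"
proof (intro conjI impI)
  assume Ia: "comm_ideal \<subseteq> a"
  interpret ordered_quotient 1 "comm_ideal :: 'n free_alg set" lt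
    by (intro ordered_quotient.intro quadratic_quotient_comm ordered_quotient_axioms.intro assms(1))
  have sym_std: "sym_word = std"
    by (rule ext) (simp add: sym_word_def std_def word_sign_sym)
  have pairs: "{X i * X j | i j :: 'n. i > j} = {X i * X j | i j. \<not> std [i, j]}"
    by (simp add: sym_std[symmetric] sym_word_def not_le)
  show "minimally_generates T
          (delta comm_ideal sym_word `
             min_gens (T Quot comm_ideal) (quot_monomials comm_ideal sym_word)
               (gin_Q comm_ideal sym_word lt (proj comm_ideal ` a))
           \<union> {X i * X j | i j. i > j})
          (gin_T (sym_word_order lt) a)"
    unfolding sym_std pairs
  proof (rule gin_minimally_generated[OF assms(3) Ia assms(2,4)])
    fix v w :: "'n list"
    show "word_lt v w" if "std w" "sym_word_order lt v w"
      using that not_lex_less_sorted by (auto simp: std_def sym_word_order_def)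
    show "sym_word_order lt v w" if "word_lt v w"
      using that by (simp add: sym_word_order_def)
    show "sym_word_order lt (sort w) w" if "\<not> sorted w"
      using lex_less_sort[OF that] by (simp add: sym_word_order_def)
  qed
next
  assume Ia: "anticomm_ideal \<subseteq> a"
  interpret ordered_quotient "- 1" "anticomm_ideal :: 'n free_alg set" lt
    by (intro ordered_quotient.intro quadratic_quotient_anticomm ordered_quotient_axioms.intro assms(1))
  have ext_std: "ext_word = std"
    by (rule ext) (auto simp: ext_word_def std_def word_sign_nonzero_iff strict_sorted_iff)
  have pairs: "{X i * X j | i j :: 'n. i \<ge> j} = {X i * X j | i j. \<not> std [i, j]}"
    by (simp add: ext_std[symmetric] ext_word_def not_less)
  show "minimally_generates T
          (delta anticomm_ideal ext_word `
             min_gens (T Quot anticomm_ideal) (quot_monomials anticomm_ideal ext_word)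
               (gin_Q anticomm_ideal ext_word lt (proj anticomm_ideal ` a))
           \<union> {X i * X j | i j. i \<ge> j})
          (gin_T (ext_word_order lt) a)"
    unfolding ext_std pairs
  proof (rule gin_minimally_generated[OF assms(3) Ia assms(2,4)])
    fix v w :: "'n list"
    show "word_lt v w" if "std w" "word_sign v \<noteq> 0" "ext_word_order lt v w"
      using that not_lex_less_sorted by (auto simp: std_def ext_word_order_def mon_in_I_iff)
    show "ext_word_order lt v w" if "std v" "std w" "word_lt v w"
      using that by (simp add: ext_word_order_def mon_in_I_iff std_def)
    show "ext_word_order lt (sort w) w" if "word_sign w \<noteq> 0" "\<not> sorted w"
      using that lex_less_sort[OF that(2)] word_sign_mset[of "sort w" w]
      by (simp add: ext_word_order_def mon_in_I_iff)
  qed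
qed

end
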